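(* Let $f$ be a positive integer-valued function on the positive integers satisfying $f(n)=o(n)$, let $t\geq1$ be a fixed integer, and assume that $n$ is sufficiently large. Set $P_n=\lceil n/3-10f(n)\rceil$. If every $f(n)$-vertex subgraph of the Kneser graph $KG(P_n,21f(n))$ is $t$-colorable, then every $n$-vertex $K_3$-free graph with minimum degree at least $\frac{1}{3}n-f(n)$ is $(t+10^{391})$-colorable.
   Context: All graphs are finite and simple. For positive integers $m,k$, the Kneser graph $KG(m,k)$ has as vertex set the collection of all $m$-element subsets of $\{1,\dots,2m+k\}$, two vertices being adjacent if and only if the corresponding subsets are disjoint (often denoted $KG(2m+k,m)$). An $m$-vertex subgraph is a subgraph with exactly $m$ vertices. *)

theory Defs
  imports
    Complex_Main
    "HOL-Library.Landau_Symbols"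
    "Graph_Theory.Graph_Theory"
begin

text \<open>
  Finite simple graphs are rendered by the locale \<^locale>\<open>pair_graph\<close>: finite, loop-free,
  symmetric digraphs whose arcs are ordered pairs of vertices. An undirected edge is the pair
  of its two orientations, so the degree of a vertex is its out-degree.
\<close>

definition kneser_graph :: "nat \<Rightarrow> nat \<Rightarrow> nat set pair_pre_digraph" where
  "kneser_graph m k =
     (let V = {A. A \<subseteq> {1..2 * m + k} \<and> card A = m}
      in \<lparr>pverts = V, parcs = {(A, B). A \<in> V \<and> B \<in> V \<and> A \<inter> B = {}}\<rparr>)"

text \<open>The case \<open>m = 0\<close> is excluded in the lemma below because there the empty set would carry a loop.\<close>

lemma pair_graph_kneser_graph:
  assumes "m > 0"
  shows "pair_graph (kneser_graph m k)"
proof -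
  define V where "V = {A. A \<subseteq> {1..2 * m + k} \<and> card A = m}"
  have K: "pverts (kneser_graph m k) = V"
    "parcs (kneser_graph m k) = {(A, B). A \<in> V \<and> B \<in> V \<and> A \<inter> B = {}}"
    unfolding kneser_graph_def V_def Let_def by simp_all
  have fin: "finite V"
    unfolding V_def by (rule finite_subset[of _ "Pow {1..2 * m + k}"]) auto
  have ne: "A \<noteq> {}" if "A \<in> V" for A
    using that assms unfolding V_def by auto
  show ?thesis
  proof
    show "finite (parcs (kneser_graph m k))"
      unfolding K(2) by (rule finite_subset[of _ "V \<times> V"]) (use fin in auto)
    show "symmetric (with_proj (kneser_graph m k))"
      unfolding symmetric_def with_proj_simps K(2) by (rule symI) blast
    show "fst e \<noteq> snd e" if "e \<in> parcs (kneser_graph m k)" for e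
      using that ne unfolding K(2) by force
  qed (use fin in \<open>auto simp only: K split_beta mem_Collect_eq\<close>)
qed

definition colorable :: "'a pair_pre_digraph \<Rightarrow> nat \<Rightarrow> bool" where
  "colorable G k \<longleftrightarrow>
     (\<exists>c :: 'a \<Rightarrow> nat. (\<forall>v \<in> pverts G. c v < k) \<and> (\<forall>(u, v) \<in> parcs G. c u \<noteq> c v))"

definition clique_free :: "nat \<Rightarrow> 'a pair_pre_digraph \<Rightarrow> bool" where
  "clique_free r G \<longleftrightarrow>
     \<not> (\<exists>H :: 'a pair_pre_digraph.
          subgraph (with_proj H) (with_proj G) \<and> complete_digraph r (with_proj H))"

text \<open>Meaningful only for finite graphs with at least one vertex.\<close>

definition min_degree :: "'a pair_pre_digraph \<Rightarrow> nat" where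
  "min_degree G = Min (out_degree (with_proj G) ` pverts G)"

end

theory Submission
  imports Defs "HOL-Analysis.Convex"
begin

text \<open>
  Sample finitely many vertex sets \<open>S\<close>, each of them the set of all vertices not adjacent to some
  \<open>q\<close>-tuple, and give the colour \<open>S\<close> to every vertex whose neighbourhood contains more than half of
  \<open>S\<close>; adjacent vertices have disjoint neighbourhoods, so colour classes are independent. A moment
  argument makes one sample of size \<open>4 ^ 600\<close> work for all vertices: a vertex \<open>v\<close> left uncoloured has
  at least about \<open>2 n / 3\<close> vertices with few neighbours in \<open>N v\<close>. If two uncoloured vertices are adjacent,
  this forces a Hajnal-like structure: an independent set \<open>I\<close> of nearly \<open>2 n / 3\<close> vertices whose
  complement \<open>J\<close> splits into an isolated independent part \<open>Z\<close> and a part \<open>W\<close> of vertices adjacent to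
  about half of \<open>I\<close>. Vertices with a neighbourhood in \<open>W\<close> of size linear in \<open>card W\<close> take six colours.
  The others are independent if \<open>card W\<close> is large compared with \<open>f n\<close>; otherwise a few neighbourhoods of vertices
  of \<open>I\<close> cover all but \<open>f n\<close> of them, and these map into the Kneser graph on \<open>I\<close>
  by \<open>w \<mapsto> N w \<inter> I\<close>, cut down to subsets of equal size.
\<close>

section \<open>Sampling moments\<close>

text \<open>Derandomised variance bound: averaged over the next point \<open>p\<close>, the cross
  term with the partial sum vanishes because \<open>\<mu>\<close> is the mean, so some
  \<open>p\<close> raises the squared norm by at most \<open>C\<close>.\<close>

lemma exists_balanced_sample:
  fixes \<phi> :: "'p \<Rightarrow> 'i \<Rightarrow> real"
  assumes fin: "finite Q" "Q \<noteq> {}"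
    and C: "\<And>p. p \<in> Q \<Longrightarrow> (\<Sum>\<tau>\<in>I. (\<phi> p \<tau>)\<^sup>2) \<le> C"
  defines "\<mu> \<equiv> \<lambda>\<tau>. (\<Sum>p\<in>Q. \<phi> p \<tau>) / card Q"
  shows "\<exists>P. (\<forall>i<s. P i \<in> Q) \<and> (\<Sum>\<tau>\<in>I. (\<Sum>i<s. \<mu> \<tau> - \<phi> (P i) \<tau>)\<^sup>2) \<le> real s * C"
proof (induction s)
  case (Suc s)
  then obtain P where P: "\<And>i. i < s \<Longrightarrow> P i \<in> Q"
    and le: "(\<Sum>\<tau>\<in>I. (\<Sum>i<s. \<mu> \<tau> - \<phi> (P i) \<tau>)\<^sup>2) \<le> real s * C"
    by blast
  define G where "G \<tau> = (\<Sum>i<s. \<mu> \<tau> - \<phi> (P i) \<tau>)" for \<tau>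
  have card: "real (card Q) > 0"
    using fin by (simp add: card_gt_0_iff)
  have pointwise: "(\<Sum>p\<in>Q. (G \<tau> + (\<mu> \<tau> - \<phi> p \<tau>))\<^sup>2)
      \<le> card Q * (G \<tau>)\<^sup>2 + (\<Sum>p\<in>Q. (\<phi> p \<tau>)\<^sup>2)" for \<tau>
  proof -
    have \<mu>: "(\<Sum>p\<in>Q. \<phi> p \<tau>) = card Q * \<mu> \<tau>"
      using card unfolding \<mu>_def by simp
    have "(\<Sum>p\<in>Q. (G \<tau> + (\<mu> \<tau> - \<phi> p \<tau>))\<^sup>2)
        = (\<Sum>p\<in>Q. (G \<tau> + \<mu> \<tau>)\<^sup>2 - 2 * (G \<tau> + \<mu> \<tau>) * \<phi> p \<tau> + (\<phi> p \<tau>)\<^sup>2)"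
      by (intro sum.cong) (auto simp: power2_eq_square algebra_simps)
    also have "\<dots> = card Q * (G \<tau> + \<mu> \<tau>)\<^sup>2 - 2 * (G \<tau> + \<mu> \<tau>) * (\<Sum>p\<in>Q. \<phi> p \<tau>)
        + (\<Sum>p\<in>Q. (\<phi> p \<tau>)\<^sup>2)"
      by (simp add: sum.distrib sum_subtractf sum_distrib_left)
    also have "\<dots> = card Q * (G \<tau>)\<^sup>2 - card Q * (\<mu> \<tau>)\<^sup>2 + (\<Sum>p\<in>Q. (\<phi> p \<tau>)\<^sup>2)"
      unfolding \<mu> by (simp add: power2_eq_square algebra_simps)
    finally show ?thesis by simp
  qed
  have "(\<Sum>p\<in>Q. \<Sum>\<tau>\<in>I. (G \<tau> + (\<mu> \<tau> - \<phi> p \<tau>))\<^sup>2)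
      = (\<Sum>\<tau>\<in>I. \<Sum>p\<in>Q. (G \<tau> + (\<mu> \<tau> - \<phi> p \<tau>))\<^sup>2)"
    by (rule sum.swap)
  also have "\<dots> \<le> (\<Sum>\<tau>\<in>I. card Q * (G \<tau>)\<^sup>2 + (\<Sum>p\<in>Q. (\<phi> p \<tau>)\<^sup>2))"
    by (rule sum_mono) (rule pointwise)
  also have "\<dots> = card Q * (\<Sum>\<tau>\<in>I. (G \<tau>)\<^sup>2) + (\<Sum>p\<in>Q. \<Sum>\<tau>\<in>I. (\<phi> p \<tau>)\<^sup>2)"
    by (simp add: sum.distrib sum_distrib_left sum.swap[of _ Q])
  also have "\<dots> \<le> card Q * (\<Sum>\<tau>\<in>I. (G \<tau>)\<^sup>2) + card Q * C"
    using sum_bounded_above[of Q "\<lambda>p. \<Sum>\<tau>\<in>I. (\<phi> p \<tau>)\<^sup>2" C] C by simp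
  also have "\<dots> \<le> card Q * (real s * C) + card Q * C"
    using le card unfolding G_def by (simp add: mult_left_mono)
  also have "\<dots> = (\<Sum>p\<in>Q. real (Suc s) * C)"
    by (simp add: algebra_simps)
  finally have le': "(\<Sum>p\<in>Q. \<Sum>\<tau>\<in>I. (G \<tau> + (\<mu> \<tau> - \<phi> p \<tau>))\<^sup>2) \<le> (\<Sum>p\<in>Q. real (Suc s) * C)" .
  have "\<exists>p\<in>Q. (\<Sum>\<tau>\<in>I. (G \<tau> + (\<mu> \<tau> - \<phi> p \<tau>))\<^sup>2) \<le> real (Suc s) * C"
  proof (rule ccontr)
    assume neg: "\<not> ?thesis"
    have "(\<Sum>p\<in>Q. real (Suc s) * C) < (\<Sum>p\<in>Q. \<Sum>\<tau>\<in>I. (G \<tau> + (\<mu> \<tau> - \<phi> p \<tau>))\<^sup>2)"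
      by (rule sum_strict_mono[OF fin]) (use neg in \<open>simp only: not_le bex_simps ball_simps\<close>)
    then show False using le' by linarith
  qed
  then obtain p where p: "p \<in> Q"
    "(\<Sum>\<tau>\<in>I. (G \<tau> + (\<mu> \<tau> - \<phi> p \<tau>))\<^sup>2) \<le> real (Suc s) * C" ..
  show ?case
    by (rule exI[of _ "P(s := p)"]) (use P p in \<open>auto simp: G_def less_Suc_eq\<close>)
qed simp

text \<open>
  Expanding \<open>card (A \<inter> S p) ^ k\<close> as the number of \<open>k\<close>-tuples over \<open>A\<close> that lie in \<open>S p\<close> makes it
  a linear functional of \<open>A ^ k\<close>; hence one sample works for all sets \<open>A\<close> simultaneously.
\<close>

lemma exists_moment_sample:
  fixes S :: "'p \<Rightarrow> 'a set" and k s m :: nat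
  assumes fin: "finite V" "finite Q" "Q \<noteq> {}"
    and S: "\<And>p. p \<in> Q \<Longrightarrow> S p \<subseteq> V" "\<And>p. p \<in> Q \<Longrightarrow> m \<le> card (S p)"
    and pos: "m > 0" "s > 0"
  defines "r \<equiv> \<lambda>A p. (card (A \<inter> S p) / card (S p)) ^ k"
  shows "\<exists>P. (\<forall>i<s. P i \<in> Q) \<and>
    (\<forall>A\<subseteq>V. card A \<le> m \<longrightarrow> (\<Sum>p\<in>Q. r A p) / card Q \<le> (\<Sum>i<s. r A (P i)) / s + 1 / sqrt s)"
proof -
  define L where "L A = {xs. set xs \<subseteq> A \<and> length xs = k}" for A :: "'a set"
  have finL: "finite (L A)" and cardL: "card (L A) = card A ^ k" if "A \<subseteq> V" for A
    using that fin(1) unfolding L_def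
    by (auto intro: finite_lists_length_eq finite_subset card_lists_length_eq)
  define \<phi> where "\<phi> p \<tau> = (if set \<tau> \<subseteq> S p then 1 / real (card (S p)) ^ k else 0)" for p \<tau>
  define \<mu> where "\<mu> \<tau> = (\<Sum>p\<in>Q. \<phi> p \<tau>) / card Q" for \<tau>
  have \<phi>_sum: "(\<Sum>\<tau>\<in>L A. \<phi> p \<tau>) = r A p" if "A \<subseteq> V" "p \<in> Q" for A p
  proof -
    have "(\<Sum>\<tau>\<in>L A. \<phi> p \<tau>) = (\<Sum>\<tau>\<in>L (A \<inter> S p). 1 / real (card (S p)) ^ k)"
      unfolding \<phi>_def using finL[OF that(1)]
      by (intro sum.mono_neutral_cong_right) (auto simp: L_def)
    also have "\<dots> = r A p"
      using cardL[of "A \<inter> S p"] that by (simp add: r_def power_divide le_infI1)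
    finally show ?thesis .
  qed
  \<comment> \<open>\<open>\<phi> p\<close> is constant on \<open>card (S p) ^ k\<close> tuples,
    zero elsewhere, and has total 1, so its squared norm is that constant value.\<close>
  have norm: "(\<Sum>\<tau>\<in>L V. (\<phi> p \<tau>)\<^sup>2) \<le> 1 / real m ^ k" if "p \<in> Q" for p
  proof -
    have m: "0 < m" "m \<le> card (S p)" using S(2)[OF that] pos by auto
    have "(\<Sum>\<tau>\<in>L V. (\<phi> p \<tau>)\<^sup>2) = (\<Sum>\<tau>\<in>L V. \<phi> p \<tau>) * (1 / real (card (S p)) ^ k)"
      unfolding sum_distrib_right by (intro sum.cong) (auto simp: \<phi>_def power2_eq_square)
    also have "\<dots> = 1 / real (card (S p)) ^ k"
      using \<phi>_sum[of V p] that S(1)[OF that] m by (simp add: r_def Int_absorb1)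
    also have "\<dots> \<le> 1 / real m ^ k"
      using m by (intro divide_left_mono power_mono mult_pos_pos zero_less_power) auto
    finally show ?thesis .
  qed
  have "\<exists>P. (\<forall>i<s. P i \<in> Q) \<and>
      (\<Sum>\<tau>\<in>L V. (\<Sum>i<s. \<mu> \<tau> - \<phi> (P i) \<tau>)\<^sup>2) \<le> real s * (1 / real m ^ k)"
    unfolding \<mu>_def by (rule exists_balanced_sample[OF fin(2,3) norm])
  then obtain P where P: "\<And>i. i < s \<Longrightarrow> P i \<in> Q"
    and le: "(\<Sum>\<tau>\<in>L V. (\<Sum>i<s. \<mu> \<tau> - \<phi> (P i) \<tau>)\<^sup>2) \<le> real s * (1 / real m ^ k)"
    by blast
  have "(\<Sum>p\<in>Q. r A p) / card Q \<le> (\<Sum>i<s. r A (P i)) / s + 1 / sqrt s"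
    if A: "A \<subseteq> V" "card A \<le> m" for A
  proof -
    define D where "D \<tau> = (\<Sum>i<s. \<mu> \<tau> - \<phi> (P i) \<tau>)" for \<tau>
    \<comment> \<open>Cauchy-Schwarz: the at most \<open>m ^ k\<close> tuples over \<open>A\<close>
      cancel the norm bound \<open>1 / m ^ k\<close>, leaving an error independent of
      \<open>A\<close>, \<open>k\<close> and \<open>m\<close>.\<close>
    have "(\<Sum>\<tau>\<in>L A. D \<tau>)\<^sup>2 \<le> (\<Sum>\<tau>\<in>L A. (D \<tau>)\<^sup>2) * card (L A)"
      by (rule sum_squared_le_sum_of_squares)
    also have "\<dots> \<le> (real s * (1 / real m ^ k)) * real m ^ k"
    proof (rule mult_mono)
      have "(\<Sum>\<tau>\<in>L A. (D \<tau>)\<^sup>2) \<le> (\<Sum>\<tau>\<in>L V. (D \<tau>)\<^sup>2)"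
        using A finL[of V] by (intro sum_mono2) (auto simp: L_def)
      then show "(\<Sum>\<tau>\<in>L A. (D \<tau>)\<^sup>2) \<le> real s * (1 / real m ^ k)"
        using le unfolding D_def by linarith
      show "real (card (L A)) \<le> real m ^ k"
        using A cardL[OF A(1)] by (simp add: power_mono)
    qed (auto simp: sum_nonneg)
    also have "\<dots> = s" using pos by simp
    finally have "(\<Sum>\<tau>\<in>L A. D \<tau>) \<le> sqrt s"
      by (rule real_le_rsqrt)
    moreover have "(\<Sum>\<tau>\<in>L A. D \<tau>) = s * ((\<Sum>p\<in>Q. r A p) / card Q) - (\<Sum>i<s. r A (P i))"
    proof -
      have "(\<Sum>\<tau>\<in>L A. D \<tau>) = (\<Sum>i<s. (\<Sum>\<tau>\<in>L A. \<mu> \<tau>) - (\<Sum>\<tau>\<in>L A. \<phi> (P i) \<tau>))"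
        unfolding D_def by (subst sum.swap) (simp add: sum_subtractf)
      also have "\<dots> = s * (\<Sum>\<tau>\<in>L A. \<mu> \<tau>) - (\<Sum>i<s. r A (P i))"
        using \<phi>_sum[OF A(1)] P by (simp add: sum_subtractf)
      also have "(\<Sum>\<tau>\<in>L A. \<mu> \<tau>) = (\<Sum>p\<in>Q. r A p) / card Q"
      proof -
        have "(\<Sum>\<tau>\<in>L A. \<mu> \<tau>) = (\<Sum>\<tau>\<in>L A. \<Sum>p\<in>Q. \<phi> p \<tau>) / card Q"
          unfolding \<mu>_def by (rule sum_divide_distrib[symmetric])
        also have "(\<Sum>\<tau>\<in>L A. \<Sum>p\<in>Q. \<phi> p \<tau>) = (\<Sum>p\<in>Q. \<Sum>\<tau>\<in>L A. \<phi> p \<tau>)"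
          by (rule sum.swap)
        also have "\<dots> = (\<Sum>p\<in>Q. r A p)"
          using \<phi>_sum[OF A(1)] by (intro sum.cong) auto
        finally show ?thesis .
      qed
      finally show ?thesis .
    qed
    ultimately have "s * ((\<Sum>p\<in>Q. r A p) / card Q) \<le> (\<Sum>i<s. r A (P i)) + sqrt s"
      by linarith
    then have "(\<Sum>p\<in>Q. r A p) / card Q \<le> ((\<Sum>i<s. r A (P i)) + sqrt s) / s"
      using pos by (simp add: pos_le_divide_eq mult.commute)
    also have "\<dots> = (\<Sum>i<s. r A (P i)) / s + 1 / sqrt s"
    proof -
      have "sqrt s / s = 1 / sqrt s"
        using pos by (simp add: frac_eq_eq)
      then show ?thesis by (simp add: add_divide_distrib)
    qed
    finally show ?thesis .
  qed
  with P show ?thesis by blast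
qed

section \<open>Triangle-free graphs given by their neighbourhoods\<close>

text \<open>By \<open>sym\<close> and \<open>sub\<close>, a vertex with a neighbour lies in
  \<open>V\<close>, so \<open>N v\<close> is empty outside \<open>V\<close>. Loops are excluded by
  \<open>triangle_free\<close>: \<open>u \<in> N u\<close> would put \<open>u\<close> into
  \<open>N u \<inter> N u = {}\<close>.\<close>

locale triangle_free_nbhds =
  fixes V :: "'a set" and N :: "'a \<Rightarrow> 'a set"
  assumes fin [simp]: "finite V"
    and sub: "N v \<subseteq> V"
    and sym: "u \<in> N v \<Longrightarrow> v \<in> N u"
    and triangle_free: "u \<in> N v \<Longrightarrow> N u \<inter> N v = {}"
begin

lemma fin_N [simp]: "finite (N v)"
  using fin sub finite_subset by blast

lemma card_Un_nbhds_le: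
  assumes "u \<in> N v" "finite X"
  shows "card (N u \<inter> X) + card (N v \<inter> X) \<le> card X"
proof -
  have "card (N u \<inter> X) + card (N v \<inter> X) = card ((N u \<inter> X) \<union> (N v \<inter> X))"
    using triangle_free[OF assms(1)] by (intro card_Un_disjoint[symmetric]) auto
  also have "\<dots> \<le> card X"
    using assms(2) by (intro card_mono) auto
  finally show ?thesis .
qed

lemma double_count:
  assumes "finite X" "finite Y"
  shows "(\<Sum>x\<in>X. card (N x \<inter> Y)) = (\<Sum>y\<in>Y. card (N y \<inter> X))"
proof -
  have *: "card (N x \<inter> Z) = (\<Sum>z\<in>Z. if z \<in> N x then 1 else 0)" if "finite Z" for x Z
    using that by (simp add: sum.If_cases Int_commute)
  have "(\<Sum>x\<in>X. card (N x \<inter> Y)) = (\<Sum>x\<in>X. \<Sum>y\<in>Y. if y \<in> N x then 1 else 0)"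
    using assms by (simp add: *)
  also have "\<dots> = (\<Sum>y\<in>Y. \<Sum>x\<in>X. if x \<in> N y then 1 else 0)"
    by (subst sum.swap) (auto intro!: sum.cong dest: sym)
  finally show ?thesis
    using assms by (simp add: *)
qed

definition colorable_on :: "'a set \<Rightarrow> nat \<Rightarrow> bool" where
  "colorable_on X k \<longleftrightarrow>
     (\<exists>c. (\<forall>v\<in>X. c v < k) \<and> (\<forall>u\<in>X. \<forall>v\<in>X. u \<in> N v \<longrightarrow> c u \<noteq> (c v :: nat)))"

lemma colorable_on_mono:
  assumes "colorable_on X k" "Y \<subseteq> X" "k \<le> l"
  shows "colorable_on Y l"
proof -
  from assms(1) obtain c where "\<forall>v\<in>X. c v < k" "\<forall>u\<in>X. \<forall>v\<in>X. u \<in> N v \<longrightarrow> c u \<noteq> (c v :: nat)"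
    unfolding colorable_on_def by blast
  then show ?thesis
    unfolding colorable_on_def using assms(2,3) by (intro exI[of _ c]) (meson order_less_le_trans subsetD)
qed

lemma colorable_on_Un:
  assumes "colorable_on X k" "colorable_on Y l"
  shows "colorable_on (X \<union> Y) (k + l)"
proof -
  from assms obtain c d where
    c: "\<forall>v\<in>X. c v < k" "\<forall>u\<in>X. \<forall>v\<in>X. u \<in> N v \<longrightarrow> c u \<noteq> (c v :: nat)" and
    d: "\<forall>v\<in>Y. d v < l" "\<forall>u\<in>Y. \<forall>v\<in>Y. u \<in> N v \<longrightarrow> d u \<noteq> (d v :: nat)"
    unfolding colorable_on_def by blast
  show ?thesis
    unfolding colorable_on_def
  proof (intro exI[of _ "\<lambda>v. if v \<in> X then c v else k + d v"] conjI ballI impI)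
    fix u v
    assume uv: "u \<in> X \<union> Y" "v \<in> X \<union> Y" "u \<in> N v"
    show "(if u \<in> X then c u else k + d u) \<noteq> (if v \<in> X then c v else k + d v)"
    proof (cases "u \<in> X"; cases "v \<in> X")
      assume "u \<in> X" "v \<notin> X"
      then have "c u < k" using c(1) by blast
      then show ?thesis using \<open>u \<in> X\<close> \<open>v \<notin> X\<close> by simp
    next
      assume "u \<notin> X" "v \<in> X"
      then have "c v < k" using c(1) by blast
      then show ?thesis using \<open>u \<notin> X\<close> \<open>v \<in> X\<close> by simp
    qed (use uv c d in auto)
  qed (use c d in auto)
qed

lemma colorable_on_indep:
  assumes "\<And>u v. u \<in> X \<Longrightarrow> v \<in> X \<Longrightarrow> u \<notin> N v"
  shows "colorable_on X 1"
  unfolding colorable_on_def using assms by (intro exI[of _ "\<lambda>_. 0"]) auto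

lemma colorable_on_indep_cover:
  assumes "\<And>x. x \<in> X \<Longrightarrow> \<exists>i<k. x \<in> S i"
    and "\<And>i u v. i < k \<Longrightarrow> u \<in> S i \<Longrightarrow> v \<in> S i \<Longrightarrow> u \<notin> N v"
  shows "colorable_on X (k :: nat)"
proof -
  obtain c where "\<And>x. x \<in> X \<Longrightarrow> c x < k \<and> x \<in> S (c x)"
    using assms(1) by metis
  then show ?thesis
    unfolding colorable_on_def using assms(2) by (intro exI[of _ c]) metis
qed

section \<open>Majority colouring by sampled common non-neighbourhoods\<close>

lemma majority_indep:
  assumes "finite S" "2 * card (N u \<inter> S) > card S" "2 * card (N v \<inter> S) > card S"
  shows "u \<notin> N v"
  using card_Un_nbhds_le[of u v S] assms by linarith

text \<open>
  The sets \<open>S i\<close> are sampled from the sets of all vertices not adjacent to a given \<open>q\<close>-tuple. If the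
  tuple lies in \<open>A \<subseteq> N v\<close>, then such a set contains \<open>A\<close>, and its average size is the right-hand side
  of the second alternative; so if this average is below \<open>2 * m\<close>, the \<open>k\<close>-th moment over all tuples is
  large, and a sampled set must show a majority.
\<close>

lemma exists_majority_sets:
  fixes k q m :: nat and T :: real
  assumes m: "m > 0" and T: "T > 0"
    and large: "(m / card V) ^ q * (2 * m / T) ^ k > 2"
  shows "\<exists>S :: nat \<Rightarrow> 'a set. (\<forall>i. S i \<subseteq> V) \<and> (\<forall>v. (\<exists>i < 4 ^ k. 2 * card (N v \<inter> S i) > card (S i)) \<or>
    (\<forall>A \<subseteq> N v. card A = m \<longrightarrow> T < (\<Sum>u\<in>V. (card (A - N u) / m) ^ q)))"
proof (cases "\<exists>v. \<exists>A \<subseteq> N v. card A = m")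
  case False
  \<comment> \<open>No neighbourhood contains \<open>m\<close> vertices, so the second alternative
    is vacuous.\<close>
  then show ?thesis by (intro exI[of _ "\<lambda>_. {}"]) auto
next
  case True
  \<comment> \<open>This size makes the sampling error \<open>1 / sqrt s\<close> equal to
    \<open>(1/2) ^ k\<close>, the bound on the \<open>k\<close>-th power of a ratio without
    majority.\<close>
  define s :: nat where "s = 4 ^ k"
  define L where "L A = {z. set z \<subseteq> A \<and> length z = q}" for A :: "'a set"
  have finL: "finite (L A)" and cardL: "card (L A) = card A ^ q" if "A \<subseteq> V" for A
    using finite_subset[OF that fin] unfolding L_def
    by (auto intro: finite_lists_length_eq card_lists_length_eq)
  define S where "S z = {u \<in> V. N u \<inter> set z = {}}" for z
  \<comment> \<open>The sampling lemma needs \<open>m \<le> card (S z)\<close>. Tuples over an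
    \<open>m\<close>-set inside some \<open>N v\<close> all survive, since \<open>S z\<close> then
    contains that set.\<close>
  define Q where "Q = {z \<in> L V. m \<le> card (S z)}"
  have finQ: "finite Q" unfolding Q_def using finL[of V] by simp
  have sup: "A \<subseteq> S z" if "A \<subseteq> N v" "z \<in> L A" for A v z
    using that sub triangle_free unfolding S_def L_def by blast
  have LQ: "z \<in> Q" if "A \<subseteq> N v" "card A = m" "z \<in> L A" for A v z
  proof -
    have "card A \<le> card (S z)"
      using sup[OF that(1,3)] by (intro card_mono) (auto simp: S_def)
    then show ?thesis using that sub unfolding Q_def L_def by blast
  qed
  from True obtain v0 A0 where A0: "A0 \<subseteq> N v0" "card A0 = m" by blast
  then have "L A0 \<noteq> {}"
    using cardL[of A0] m sub by fastforce
  then have neQ: "Q \<noteq> {}" using LQ[OF A0] by blast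
  from A0 have V: "card V > 0"
    using m sub by (metis card_gt_0_iff fin subset_empty less_nat_zero_code order_trans card.empty)
  have "\<exists>P. (\<forall>i<s. P i \<in> Q) \<and>
      (\<forall>A\<subseteq>V. card A \<le> m \<longrightarrow> (\<Sum>z\<in>Q. (card (A \<inter> S z) / card (S z)) ^ k) / card Q
        \<le> (\<Sum>i<s. (card (A \<inter> S (P i)) / card (S (P i))) ^ k) / s + 1 / sqrt s)"
    by (rule exists_moment_sample) (use finQ neQ m in \<open>auto simp: S_def Q_def s_def\<close>)
  then obtain P where P: "\<And>i. i < s \<Longrightarrow> P i \<in> Q"
    and le: "\<And>A. A \<subseteq> V \<Longrightarrow> card A \<le> m \<Longrightarrow> (\<Sum>z\<in>Q. (card (A \<inter> S z) / card (S z)) ^ k) / card Q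
        \<le> (\<Sum>i<s. (card (A \<inter> S (P i)) / card (S (P i))) ^ k) / s + 1 / sqrt s"
    by blast
  have "T < (\<Sum>u\<in>V. (card (A - N u) / m) ^ q)"
    if A: "A \<subseteq> N v" "card A = m" and minor: "\<not> (\<exists>i < s. 2 * card (N v \<inter> S (P i)) > card (S (P i)))"
    for v A
  proof (rule ccontr)
    assume small: "\<not> T < (\<Sum>u\<in>V. (card (A - N u) / m) ^ q)"
    have AV: "A \<subseteq> V" using A sub by blast
    have finA: "finite A" using AV fin finite_subset by blast
    have "(\<Sum>z\<in>Q. (card (A \<inter> S z) / card (S z)) ^ k) / card Q
        \<le> (\<Sum>i<s. (card (A \<inter> S (P i)) / card (S (P i))) ^ k) / s + 1 / sqrt s"
      using le[OF AV] A by simp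
    also have "(\<Sum>i<s. (card (A \<inter> S (P i)) / card (S (P i))) ^ k) \<le> (\<Sum>i<s. (1/2 :: real) ^ k)"
    proof (intro sum_mono power_mono)
      fix i :: nat assume i: "i \<in> {..<s}"
      have "card (A \<inter> S (P i)) \<le> card (N v \<inter> S (P i))"
        using A by (intro card_mono) auto
      also have "2 * \<dots> \<le> card (S (P i))" using minor i by (meson lessThan_iff not_less)
      finally have "2 * card (A \<inter> S (P i)) \<le> card (S (P i))" by simp
      then show "card (A \<inter> S (P i)) / card (S (P i)) \<le> 1 / 2"
        by (cases "card (S (P i)) = 0") (auto simp: field_simps)
    qed auto
    also have "(\<Sum>i<s. (1/2 :: real) ^ k) / s + 1 / sqrt s = 2 * (1/2) ^ k"
      unfolding s_def by (simp add: real_sqrt_power power_divide)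
    finally have up: "(\<Sum>z\<in>Q. (card (A \<inter> S z) / card (S z)) ^ k) / card Q \<le> 2 * (1/2) ^ k"
      by (simp add: divide_right_mono)
    have S_pos: "card (S z) > 0" if "z \<in> L A" for z
      using LQ[OF A that] m unfolding Q_def by simp
    \<comment> \<open>Counting pairs of a tuple \<open>z\<close> over \<open>A\<close> and a vertex
      \<open>u\<close> with no neighbour in \<open>z\<close> shows that \<open>card (S z)\<close> is
      at most \<open>T\<close> on average.\<close>
    have "(\<Sum>z\<in>L A. real (card (S z))) = (\<Sum>z\<in>L A. \<Sum>u\<in>V. if z \<in> L (A - N u) then 1 else 0)"
    proof (rule sum.cong[OF refl])
      fix z assume z: "z \<in> L A"
      have "S z = {u \<in> V. z \<in> L (A - N u)}"
        using z unfolding S_def L_def by blast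
      then show "real (card (S z)) = (\<Sum>u\<in>V. if z \<in> L (A - N u) then 1 else 0)"
        by (simp add: sum.If_cases Int_def)
    qed
    also have "\<dots> = (\<Sum>u\<in>V. \<Sum>z\<in>L A. if z \<in> L (A - N u) then 1 else 0)"
      by (rule sum.swap)
    also have "\<dots> = (\<Sum>u\<in>V. real (card (A - N u)) ^ q)"
    proof (rule sum.cong[OF refl])
      fix u
      have "L A \<inter> L (A - N u) = L (A - N u)" unfolding L_def by blast
      moreover have "card (L (A - N u)) = card (A - N u) ^ q"
        using AV by (intro cardL) blast
      ultimately show "(\<Sum>z\<in>L A. if z \<in> L (A - N u) then 1 else (0::real)) = real (card (A - N u)) ^ q"
        using finL[OF AV] by (simp add: sum.If_cases Int_def)
    qed
    also have "\<dots> = m ^ q * (\<Sum>u\<in>V. (card (A - N u) / m) ^ q)"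
      using m by (simp add: sum_distrib_left power_divide)
    also have "\<dots> \<le> m ^ q * T"
      using small m by (intro mult_left_mono) auto
    finally have avg: "(\<Sum>z\<in>L A. real (card (S z))) \<le> m ^ q * T" .
    \<comment> \<open>Jensen's inequality for the convex function \<open>(m / c) ^ k\<close> of
      \<open>c = card (S z)\<close>: the summand is its tangent at \<open>c = T\<close>, whose
      average is at least the value at \<open>T\<close> because \<open>c\<close> is at most
      \<open>T\<close> on average.\<close>
    have "real m ^ q * (m / T) ^ k \<le> (\<Sum>z\<in>L A. (m / T) ^ k * (1 + k * (1 - card (S z) / T)))"
    proof -
      have "(\<Sum>z\<in>L A. 1 + k * (1 - card (S z) / T))
          = m ^ q + k * (m ^ q - (\<Sum>z\<in>L A. real (card (S z))) / T)"
        using cardL[OF AV] A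
        by (simp add: sum.distrib sum_distrib_left sum_subtractf sum_divide_distrib algebra_simps)
      moreover have "(\<Sum>z\<in>L A. real (card (S z))) / T \<le> m ^ q"
        using avg T by (simp add: pos_divide_le_eq)
      ultimately have "real m ^ q \<le> (\<Sum>z\<in>L A. 1 + k * (1 - card (S z) / T))" by simp
      then have "(m / T) ^ k * real m ^ q \<le> (m / T) ^ k * (\<Sum>z\<in>L A. 1 + k * (1 - card (S z) / T))"
        using T by (intro mult_left_mono) auto
      then show ?thesis by (simp add: sum_distrib_left mult.commute)
    qed
    also have "\<dots> \<le> (\<Sum>z\<in>L A. (card (A \<inter> S z) / card (S z)) ^ k)"
    proof (rule sum_mono)
      fix z assume z: "z \<in> L A"
      define c where "c = real (card (S z))"
      have c: "c > 0" using S_pos[OF z] unfolding c_def by simp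
      \<comment> \<open>The tangent lies below the function: \<open>c / T + T / c \<ge> 2\<close>
        prepares for Bernoulli's inequality.\<close>
      have "1 - c / T \<le> T / c - 1"
        using c T sum_squares_bound[of c T] by (simp add: field_simps power2_eq_square)
      then have "1 + k * (1 - c / T) \<le> 1 + k * (T / c - 1)"
        by (intro add_left_mono mult_left_mono) auto
      also have "\<dots> \<le> (1 + (T / c - 1)) ^ k"
        using T c by (intro Bernoulli_inequality) simp
      finally have "(m / T) ^ k * (1 + k * (1 - c / T)) \<le> (m / T) ^ k * (T / c) ^ k"
        using T by (intro mult_left_mono) auto
      also have "\<dots> = (m / c) ^ k"
        using T by (simp flip: power_mult_distrib)
      finally show "(m / T) ^ k * (1 + k * (1 - card (S z) / T)) \<le> (card (A \<inter> S z) / card (S z)) ^ k"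
        using sup[OF A(1) z] A(2) unfolding c_def by (simp add: Int_absorb2)
    qed
    also have "\<dots> \<le> (\<Sum>z\<in>Q. (card (A \<inter> S z) / card (S z)) ^ k)"
      using LQ[OF A] finQ by (intro sum_mono2) auto
    also have "\<dots> \<le> (2 * (1/2) ^ k) * card Q"
      using up finQ neQ by (simp add: pos_divide_le_eq card_gt_0_iff)
    also have "\<dots> \<le> (2 * (1/2) ^ k) * card V ^ q"
    proof -
      have "card Q \<le> card (L V)"
        unfolding Q_def using finL[of V] by (intro card_mono) auto
      then have "real (card Q) \<le> card V ^ q"
        using cardL[of V] by (metis of_nat_le_iff order_refl)
      then show ?thesis by simp
    qed
    finally have "real m ^ q * (m / T) ^ k * 2 ^ k \<le> 2 * card V ^ q"
      by (simp add: field_simps)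
    then have "real m ^ q * (m / T) ^ k * 2 ^ k / card V ^ q \<le> 2"
      using V by (simp add: pos_divide_le_eq)
    then have "(m / card V) ^ q * (2 * m / T) ^ k \<le> 2"
      by (simp add: power_divide power_mult_distrib mult_ac)
    then show False using large by simp
  qed
  then show ?thesis
    by (intro exI[of _ "\<lambda>i. S (P i)"]) (auto simp: S_def s_def)
qed

text \<open>With \<open>T\<close> equal to 0.61 \<open>card V\<close>, the base
  \<open>2 * m / T\<close> exceeds 1.09, and its power 600 outweighs the loss of about
  \<open>(1/3) ^ 40\<close>. A vertex with more than 0.08 \<open>m\<close> neighbours in
  \<open>A\<close> contributes less than \<open>0.92 ^ 40 < 0.036\<close> to the sum, which leaves
  0.61 - 0.036 = 0.574.\<close>

lemma exists_majority_sets_third: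
  fixes m :: nat
  assumes V: "card V > 0" and m: "3333 / 10000 * card V \<le> m"
  shows "\<exists>S :: nat \<Rightarrow> 'a set. (\<forall>i. S i \<subseteq> V) \<and>
    (\<forall>v. (\<exists>i < 4 ^ 600. 2 * card (N v \<inter> S i) > card (S i)) \<or>
      (\<forall>A \<subseteq> N v. card A = m \<longrightarrow>
        574 / 1000 * card V \<le> card {u \<in> V. card (N u \<inter> A) \<le> 8 / 100 * real m}))"
proof -
  define k q :: nat and T where "k = 600" and "q = 40" and "T = 61 / 100 * real (card V)"
  have m_pos: "m > 0" and T: "T > 0"
    using assms unfolding T_def by auto
  \<comment> \<open>Since 600 = 15 * 40, the product is the 40th power of a single factor, which is
    compared with 6/5.\<close>
  have "(6 / 5 :: real) \<le> 3333 / 10000 * (109 / 100) ^ 15"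
    by (simp add: divide_simps)
  then have "(6 / 5 :: real) ^ 40 \<le> (3333 / 10000 * (109 / 100) ^ 15) ^ 40"
    by (rule power_mono) simp
  moreover have "(2 :: real) < (6 / 5) ^ 40"
    by (simp add: divide_simps)
  ultimately have "(2 :: real) < (3333 / 10000 * (109 / 100) ^ 15) ^ 40"
    by (rule less_le_trans[rotated])
  also have "\<dots> = (3333 / 10000) ^ q * (109 / 100) ^ k"
  proof -
    have "(a * b ^ 15) ^ 40 = a ^ 40 * b ^ 600" for a b :: real
      by (simp add: power_mult_distrib flip: power_mult)
    then show ?thesis unfolding q_def k_def .
  qed
  also have "\<dots> \<le> (m / card V) ^ q * (2 * m / T) ^ k"
    using V m by (intro mult_mono power_mono) (auto simp: T_def field_simps)
  finally obtain S :: "nat \<Rightarrow> 'a set" where S: "\<And>i. S i \<subseteq> V"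
    and alt: "\<And>v. (\<exists>i < 4 ^ k. 2 * card (N v \<inter> S i) > card (S i)) \<or>
      (\<forall>A \<subseteq> N v. card A = m \<longrightarrow> T < (\<Sum>u\<in>V. (card (A - N u) / m) ^ q))"
    using exists_majority_sets[OF m_pos T] by blast
  have wide: "574 / 1000 * card V \<le> card {u \<in> V. card (N u \<inter> A) \<le> 8 / 100 * real m}"
    if A: "A \<subseteq> N v" "card A = m" and avg: "T < (\<Sum>u\<in>V. (card (A - N u) / m) ^ q)" for v A
  proof -
    define Y where "Y = {u \<in> V. card (N u \<inter> A) \<le> 8 / 100 * real m}"
    have finA: "finite A" using finite_subset[OF A(1) fin_N] .
    have "(card (A - N u) / m) ^ q \<le> (if u \<in> Y then 1 else 0) + (92 / 100) ^ q" if "u \<in> V" for u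
    proof -
      have split: "card (A - N u) + card (N u \<inter> A) = m"
        using A(2) finA card_Diff_subset_Int[of A "N u"] card_mono[of A "N u \<inter> A"]
        by (simp add: Int_commute)
      have "(card (A - N u) / m) ^ q \<le> (if u \<in> Y then 1 else 92 / 100) ^ q"
        using split m_pos that by (intro power_mono) (auto simp: Y_def field_simps)
      also have "\<dots> \<le> (if u \<in> Y then 1 else 0) + (92 / 100) ^ q"
        by simp
      finally show ?thesis .
    qed
    then have "(\<Sum>u\<in>V. (card (A - N u) / m) ^ q) \<le> (\<Sum>u\<in>V. (if u \<in> Y then 1 else 0) + (92 / 100) ^ q)"
      by (rule sum_mono)
    also have "\<dots> = card Y + card V * (92 / 100) ^ q"
    proof -
      have "V \<inter> Y = Y" unfolding Y_def by blast
      then show ?thesis by (simp add: sum.distrib sum.If_cases)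
    qed
    also have "(92 / 100 :: real) ^ q \<le> 36 / 1000"
      unfolding q_def by (simp add: divide_simps)
    finally have "T \<le> card Y + card V * (36 / 1000)"
      using avg by (simp add: mult_left_mono)
    then show ?thesis unfolding T_def Y_def by simp
  qed
  show ?thesis
  proof (intro exI[of _ S] conjI allI)
    fix v
    show "(\<exists>i < 4 ^ 600. 2 * card (N v \<inter> S i) > card (S i)) \<or>
      (\<forall>A \<subseteq> N v. card A = m \<longrightarrow>
        574 / 1000 * card V \<le> card {u \<in> V. card (N u \<inter> A) \<le> 8 / 100 * real m})"
      using alt[of v] wide[of _ v] unfolding k_def by blast
  qed (rule S)
qed

section \<open>Edge counts between dense pairs\<close>

lemma dense_pair_bound:
  fixes a b c d :: real
  assumes XY: "finite X" "finite Y"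
    and X: "\<And>x. x \<in> X \<Longrightarrow> card (Y - N x) \<le> a"
    and Y: "\<And>y. y \<in> Y \<Longrightarrow> card (N y \<inter> X) \<le> b"
    and d: "d \<le> card Y" "a < d" and c: "b \<le> c" "b * d \<le> c * (d - a)"
  shows "card X \<le> c"
proof -
  have "card X * (card Y - a) = (\<Sum>x\<in>X. card Y - a)" by simp
  also have "\<dots> \<le> (\<Sum>x\<in>X. real (card (N x \<inter> Y)))"
  proof (rule sum_mono)
    fix x assume "x \<in> X"
    moreover have "card Y = card (Y - N x) + card (N x \<inter> Y)"
      using XY(2) card_Diff_subset_Int[of Y "N x"] card_mono[of Y "N x \<inter> Y"]
      by (simp add: Int_commute)
    ultimately show "card Y - a \<le> card (N x \<inter> Y)" using X[of x] by simp
  qed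
  also have "\<dots> = (\<Sum>y\<in>Y. real (card (N y \<inter> X)))"
    using double_count[OF XY] by (metis of_nat_sum)
  also have "\<dots> \<le> card Y * b"
    using sum_bounded_above[of Y "\<lambda>y. real (card (N y \<inter> X))" b] Y by simp
  finally have "(card X - c) * (card Y - a) \<le> (b - c) * card Y + c * a"
    by (simp add: algebra_simps)
  \<comment> \<open>As \<open>b \<le> c\<close>, the right-hand side does not increase with
    \<open>card Y\<close>, so \<open>card Y = d\<close> is the worst case.\<close>
  also have "\<dots> \<le> (b - c) * d + c * a"
    using c d by (simp add: mult_left_mono_neg)
  also have "\<dots> \<le> 0" using c(2) by (simp add: algebra_simps)
  finally show ?thesis using d by (simp add: mult_le_0_iff)
qed

text \<open>A vertex of \<open>A\<close> with few neighbours in \<open>B\<close> is joined to nearly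
  all of the remainder \<open>R\<close>. Vertices of \<open>R\<close> with few neighbours in
  \<open>A\<close> are therefore scarce, and those granted by \<open>wide\<close> outside
  \<open>A\<close> must mostly lie in \<open>B\<close>.\<close>

lemma popular_side_bound:
  fixes m :: nat
  assumes parts: "A \<subseteq> V" "B \<subseteq> V" "A \<inter> B = {}" "card A = m" "card B = m"
    and indep: "\<And>u. u \<in> A \<Longrightarrow> N u \<inter> A = {}" "\<And>u. u \<in> B \<Longrightarrow> N u \<inter> B = {}"
    and deg: "\<And>v. v \<in> V \<Longrightarrow> m \<le> card (N v)"
    and m: "3333 / 10000 * card V \<le> m" "m \<le> card V / 3" and V: "card V > 0"
    and wide: "574 / 1000 * card V \<le> card {u \<in> V. card (N u \<inter> A) \<le> 8 / 100 * real m}"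
    and A0: "466 / 10000 * card V \<le> card {u \<in> A. card (N u \<inter> B) \<le> 8 / 100 * real m}"
  shows "1776 / 10000 * card V \<le> card {u \<in> B. card (N u \<inter> A) \<le> 8 / 100 * real m}"
proof -
  define R where "R = V - A - B"
  define A0 where "A0 = {u \<in> A. card (N u \<inter> B) \<le> 8 / 100 * real m}"
  define B0 where "B0 = {u \<in> B. card (N u \<inter> A) \<le> 8 / 100 * real m}"
  define R0 where "R0 = {u \<in> R. card (N u \<inter> A) \<le> 8 / 100 * real m}"
  have finp: "finite A" "finite B" "finite R" "finite A0" "finite B0" "finite R0"
    using parts finite_subset[OF _ fin] unfolding R_def A0_def B0_def R0_def by auto
  have cardR: "card R + 2 * m = card V"
  proof -
    have "card V = card (A \<union> (B \<union> R))"
      using parts by (intro arg_cong[of _ _ card]) (auto simp: R_def)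
    also have "\<dots> = card A + (card B + card R)"
      using parts finp by (subst card_Un_disjoint; (subst card_Un_disjoint)?) (auto simp: R_def)
    finally show ?thesis using parts by simp
  qed
  have eq: "{u \<in> V. card (N u \<inter> A) \<le> 8 / 100 * real m} = A \<union> (B0 \<union> R0)"
    using parts indep(1) unfolding R_def B0_def R0_def by auto
  have "card {u \<in> V. card (N u \<inter> A) \<le> 8 / 100 * real m} \<le> m + (card B0 + card R0)"
    unfolding eq using parts(4) card_Un_le[of A "B0 \<union> R0"] card_Un_le[of B0 R0] by linarith
  with wide have sum: "574 / 1000 * card V \<le> real m + card B0 + card R0" by linarith
  have "card R0 \<le> 63 / 1000 * real (card V)"
  proof (cases "card A0 = 0")
    case True
    then show ?thesis using A0 V unfolding A0_def by simp
  next
    case False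
    \<comment> \<open>At most \<open>card V - 2 * m\<close> vertices less 0.92 \<open>m\<close>
      neighbours remain, and 1 - 2.92 * 0.3333 < 0.0268.\<close>
    have "real (card (R - N a)) \<le> 268 / 10000 * card V" if a: "a \<in> A0" for a
    proof -
      have "N a = (N a \<inter> B) \<union> (N a \<inter> R)"
        using a sub[of a] indep(1)[of a] unfolding A0_def R_def by blast
      then have "card (N a) \<le> card (N a \<inter> B) + card (N a \<inter> R)"
        using card_Un_le[of "N a \<inter> B" "N a \<inter> R"] by simp
      moreover have "card R = card (R - N a) + card (N a \<inter> R)"
        using finp card_Diff_subset_Int[of R "N a"] card_mono[of R "N a \<inter> R"]
        by (simp add: Int_commute)
      moreover have "m \<le> card (N a)" using deg a parts unfolding A0_def by blast
      moreover have "card (N a \<inter> B) \<le> 8 / 100 * real m" using a unfolding A0_def by blast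
      ultimately show ?thesis using cardR m by linarith
    qed
    have R0_A0: "card (R0 - N a) \<le> 268 / 10000 * real (card V)" if a: "a \<in> A0" for a
    proof -
      have "card (R0 - N a) \<le> card (R - N a)"
        using finp by (intro card_mono) (auto simp: R0_def)
      with \<open>\<And>a. a \<in> A0 \<Longrightarrow> _\<close>[OF a] show ?thesis by linarith
    qed
    show ?thesis
    proof (cases "card R0 > 63 / 1000 * real (card V)")
      case True
      \<comment> \<open>The choice of 0.063 gives 0.0267 * 0.063 / (0.063 - 0.0268) < 0.0465, just
        below the assumed 0.0466.\<close>
      have "card A0 \<le> 465 / 10000 * real (card V)"
      proof (rule dense_pair_bound[where Y = R0 and a = "268 / 10000 * real (card V)"
            and b = "267 / 10000 * real (card V)" and d = "63 / 1000 * real (card V)"])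
        fix y assume "y \<in> R0"
        then have "card (N y \<inter> A) \<le> 8 / 100 * real m" unfolding R0_def by blast
        moreover have "card (N y \<inter> A0) \<le> card (N y \<inter> A)"
          by (intro card_mono) (auto simp: A0_def)
        ultimately show "card (N y \<inter> A0) \<le> 267 / 10000 * real (card V)" using m by linarith
      qed (use R0_A0 finp V True in \<open>auto simp: algebra_simps\<close>)
      then show ?thesis using A0 V unfolding A0_def by simp
    qed simp
  qed
  then show ?thesis using sum m unfolding B0_def by linarith
qed

section \<open>The structure forced by two adjacent uncoloured vertices\<close>

text \<open>\<open>A\<close> and \<open>B\<close> are disjoint since \<open>v\<close> and
  \<open>w\<close> are adjacent, and the remainder \<open>R\<close> has about a third of the
  vertices. The vertices of either side with few neighbours in the other form a set \<open>Y\<close>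
  joined to nearly all of \<open>R\<close>; \<open>I\<close> collects the vertices without
  neighbours in \<open>Y\<close>.\<close>

lemma large_indep_of_wide_edge:
  fixes m :: nat
  assumes edge: "w \<in> N v" and A: "A \<subseteq> N v" "card A = m" and B: "B \<subseteq> N w" "card B = m"
    and deg: "\<And>v. v \<in> V \<Longrightarrow> m \<le> card (N v)"
    and m: "3333 / 10000 * card V \<le> m" "m \<le> card V / 3" and V: "card V > 0"
    and wideA: "574 / 1000 * card V \<le> card {u \<in> V. card (N u \<inter> A) \<le> 8 / 100 * real m}"
    and wideB: "574 / 1000 * card V \<le> card {u \<in> V. card (N u \<inter> B) \<le> 8 / 100 * real m}"
  shows "\<exists>I\<subseteq>V. (\<forall>u\<in>I. \<forall>v\<in>I. u \<notin> N v) \<and> card (V - I) \<le> 4 / 10 * real (card V) \<and>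
    (\<forall>v\<in>V - I. N v \<inter> I \<noteq> {})"
proof -
  define R where "R = V - A - B"
  define A0 where "A0 = {u \<in> A. card (N u \<inter> B) \<le> 8 / 100 * real m}"
  define B0 where "B0 = {u \<in> B. card (N u \<inter> A) \<le> 8 / 100 * real m}"
  have parts: "A \<subseteq> V" "B \<subseteq> V" "A \<inter> B = {}"
    using A B sub triangle_free[OF edge] by blast+
  have indep: "N u \<inter> A = {}" if "u \<in> A" for u
    using that A triangle_free by blast
  have indep': "N u \<inter> B = {}" if "u \<in> B" for u
    using that B triangle_free by blast
  have finp: "finite A" "finite B" "finite R"
    using parts finite_subset[OF _ fin] unfolding R_def by auto
  have cardR: "card R + 2 * m = card V"
  proof -
    have "card V = card (A \<union> (B \<union> R))"
      using parts by (intro arg_cong[of _ _ card]) (auto simp: R_def)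
    also have "\<dots> = card A + (card B + card R)"
      using parts finp by (subst card_Un_disjoint; (subst card_Un_disjoint)?) (auto simp: R_def)
    finally show ?thesis using A B by simp
  qed
  have degR: "m \<le> card (N u \<inter> A) + card (N u \<inter> B) + card (N u \<inter> R)" if "u \<in> V" for u
  proof -
    have "N u = (N u \<inter> A) \<union> (N u \<inter> B) \<union> (N u \<inter> R)"
      using sub[of u] unfolding R_def by blast
    then have "card (N u) \<le> card (N u \<inter> A) + card (N u \<inter> B) + card (N u \<inter> R)"
      using card_Un_le[of "N u \<inter> A \<union> N u \<inter> B" "N u \<inter> R"] card_Un_le[of "N u \<inter> A" "N u \<inter> B"]
      by simp
    then show ?thesis using deg[OF that] by linarith
  qed
  have splitR: "card R = card (R - N u) + card (N u \<inter> R)" for u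
    using finp card_Diff_subset_Int[of R "N u"] card_mono[of R "N u \<inter> R"]
    by (simp add: Int_commute)
  \<comment> \<open>Bootstrapping: adding both wide conditions yields 0.0466 for one side; the
    preceding lemma, applied in both directions, then raises both sides to 0.1776.\<close>
  have big: "1776 / 10000 * card V \<le> card A0 \<and> 1776 / 10000 * card V \<le> card B0"
  proof -
    have toB: "1776 / 10000 * card V \<le> card B0" if "466 / 10000 * card V \<le> card A0"
      using popular_side_bound[OF parts(1-3) A(2) B(2) indep indep' deg m V wideA] that
      unfolding A0_def B0_def by blast
    have toA: "1776 / 10000 * card V \<le> card A0" if "466 / 10000 * card V \<le> card B0"
      using popular_side_bound[OF parts(2,1) _ B(2) A(2) indep' indep deg m V wideB] that parts(3)
      unfolding A0_def B0_def by blast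
    define R1 where "R1 = {u \<in> R. card (N u \<inter> A) \<le> 8 / 100 * real m}"
    define R2 where "R2 = {u \<in> R. card (N u \<inter> B) \<le> 8 / 100 * real m}"
    have eqA: "{u \<in> V. card (N u \<inter> A) \<le> 8 / 100 * real m} = A \<union> (B0 \<union> R1)"
      using parts indep unfolding R_def B0_def R1_def by auto
    have sumA: "574 / 1000 * card V \<le> real m + card B0 + card R1"
      using wideA A(2) card_Un_le[of A "B0 \<union> R1"] card_Un_le[of B0 R1] unfolding eqA by linarith
    have eqB: "{u \<in> V. card (N u \<inter> B) \<le> 8 / 100 * real m} = B \<union> (A0 \<union> R2)"
      using parts indep' unfolding R_def A0_def R2_def by auto
    have sumB: "574 / 1000 * card V \<le> real m + card A0 + card R2"
      using wideB B(2) card_Un_le[of B "A0 \<union> R2"] card_Un_le[of A0 R2] unfolding eqB by linarith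
    \<comment> \<open>A vertex in \<open>R1\<close> and \<open>R2\<close> is adjacent to more than
      half of \<open>R\<close>, so no two such vertices are adjacent and all of them avoid
      \<open>N t\<close>.\<close>
    have T: "card (R1 \<inter> R2) \<le> 535 / 10000 * real (card V)"
    proof (cases "R1 \<inter> R2 = {}")
      case False
      have lower: "84 / 100 * m \<le> card (N t \<inter> R)" if "t \<in> R1 \<inter> R2" for t
      proof -
        have "t \<in> V" using that unfolding R1_def R_def by blast
        from degR[OF this] that show ?thesis unfolding R1_def R2_def by simp
      qed
      from False obtain t where t: "t \<in> R1 \<inter> R2" by blast
      have "t' \<notin> N t" if "t' \<in> R1 \<inter> R2" for t'
      proof
        assume "t' \<in> N t"
        from card_Un_nbhds_le[OF this finp(3)] show False
          using lower[OF t] lower[OF that] cardR m V by linarith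
      qed
      then have "R1 \<inter> R2 \<subseteq> R - N t"
        unfolding R1_def by blast
      then have "card (R1 \<inter> R2) \<le> card (R - N t)"
        using finp by (intro card_mono) auto
      then show ?thesis using splitR[of t] lower[OF t] cardR m by linarith
    qed simp
    have "card R1 + card R2 = card (R1 \<union> R2) + card (R1 \<inter> R2)"
      using finp by (intro card_Un_Int) (auto simp: R1_def R2_def)
    also have "card (R1 \<union> R2) \<le> card R"
      using finp by (intro card_mono) (auto simp: R1_def R2_def)
    finally have "real (card R1) + card R2 \<le> card R + card (R1 \<inter> R2)" by linarith
    then have "466 / 10000 * card V \<le> card A0 \<or> 466 / 10000 * card V \<le> card B0"
      using sumA sumB T cardR m by linarith
    then show ?thesis
    proof
      assume "466 / 10000 * card V \<le> card A0"
      from toB[OF this] toA show ?thesis by linarith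
    next
      assume "466 / 10000 * card V \<le> card B0"
      from toA[OF this] toB show ?thesis by linarith
    qed
  qed
  define Y where "Y = A0 \<union> B0"
  have YV: "Y \<subseteq> V" using parts unfolding Y_def A0_def B0_def by blast
  have cardY: "card Y = card A0 + card B0"
    using parts finp unfolding Y_def by (intro card_Un_disjoint) (auto simp: A0_def B0_def)
  have Y_lower: "92 / 100 * real m \<le> card (N y \<inter> R)" if "y \<in> Y" for y
  proof -
    have "y \<in> V" using that YV by blast
    from degR[OF this] show ?thesis
      using that indep[of y] indep'[of y] unfolding Y_def A0_def B0_def by auto
  qed
  have Y_miss: "card (R - N y) \<le> 268 / 10000 * real (card V)" if "y \<in> Y" for y
    using Y_lower[OF that] splitR[of y] cardR m by linarith
  define I where "I = {v \<in> V. N v \<inter> Y = {}}"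
  have I_indep: "u \<notin> N v" if "u \<in> I" "v \<in> I" for u v
  proof
    assume "u \<in> N v"
    \<comment> \<open>Both neighbourhoods avoid \<open>Y\<close> and are disjoint, but 2 * 0.3333 +
      2 * 0.1776 > 1.\<close>
    then have "card (N u \<inter> (V - Y)) + card (N v \<inter> (V - Y)) \<le> card (V - Y)"
      by (rule card_Un_nbhds_le) simp
    moreover have "N u \<inter> (V - Y) = N u" "N v \<inter> (V - Y) = N v"
      using that sub[of u] sub[of v] unfolding I_def by blast+
    moreover have "card (V - Y) + card Y = card V"
      using YV finite_subset[OF YV fin] card_mono[OF fin YV] by (simp add: card_Diff_subset)
    moreover have "m \<le> card (N u)" "m \<le> card (N v)"
      using that deg unfolding I_def by auto
    ultimately have "2 * m + card Y \<le> card V" by simp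
    then have "2 * real m + (real (card A0) + card B0) \<le> card V" using cardY by linarith
    then show False using big m V by linarith
  qed
  have YI: "Y \<subseteq> I"
  proof
    fix y assume y: "y \<in> Y"
    have "z \<notin> N y" if "z \<in> Y" for z
    proof
      assume "z \<in> N y"
      from card_Un_nbhds_le[OF this finp(3)] show False
        using Y_lower[OF y] Y_lower[OF that] cardR m V by linarith
    qed
    then show "y \<in> I" using y YV unfolding I_def by blast
  qed
  \<comment> \<open>Such a vertex has a neighbour \<open>y\<close> in \<open>Y\<close> and hence
    misses \<open>N y\<close>, which is nearly all of \<open>R\<close>.\<close>
  have miss: "card (N v \<inter> R) \<le> 268 / 10000 * real (card V)" if "v \<in> V - I" for v
  proof -
    from that obtain y where y: "y \<in> N v" "y \<in> Y" unfolding I_def by blast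
    have "card (N v \<inter> R) \<le> card (R - N y)"
      using finp triangle_free[OF y(1)] by (intro card_mono) auto
    then show ?thesis using Y_miss[OF y(2)] by linarith
  qed
  \<comment> \<open>A vertex of \<open>X - I\<close> has no neighbours in \<open>X\<close> and few
    in \<open>R\<close>, so it is joined to nearly all of \<open>Z\<close>, whereas vertices of
    \<open>Z0\<close> see little of \<open>X\<close>. The count gives 0.0267 * 0.1776 / (0.1776 -
    0.0268) < 0.032.\<close>
  have side: "card (X - I) \<le> 32 / 1000 * real (card V)"
    if X: "X \<subseteq> V" "finite X" "finite Z" "card X = m" "card Z = m" "\<And>u. u \<in> X \<Longrightarrow> N u \<inter> X = {}"
      and XZ: "\<And>u. u \<in> V \<Longrightarrow> m \<le> card (N u \<inter> X) + card (N u \<inter> Z) + card (N u \<inter> R)"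
      and Z0: "Z0 \<subseteq> Z" "1776 / 10000 * card V \<le> card Z0"
        "\<And>z. z \<in> Z0 \<Longrightarrow> card (N z \<inter> X) \<le> 8 / 100 * real m"
    for X Z Z0
  proof (rule dense_pair_bound[where Y = Z0 and a = "268 / 10000 * real (card V)"
        and b = "267 / 10000 * real (card V)" and d = "1776 / 10000 * real (card V)"])
    show "finite (X - I)" "finite Z0" using X Z0 finite_subset by auto
  next
    fix x assume x: "x \<in> X - I"
    then have xV: "x \<in> V - I" using X(1) by blast
    have "card (Z0 - N x) \<le> card (Z - N x)"
      using X(3) Z0(1) by (intro card_mono) auto
    moreover have "card Z = card (Z - N x) + card (N x \<inter> Z)"
      using X(3) card_Diff_subset_Int[of Z "N x"] card_mono[of Z "N x \<inter> Z"]
      by (simp add: Int_commute)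
    moreover have "card (N x \<inter> X) = 0" using X(6)[of x] x by simp
    ultimately show "card (Z0 - N x) \<le> 268 / 10000 * real (card V)"
      using XZ[of x] xV miss[OF xV] X(5) by simp
  next
    fix z assume "z \<in> Z0"
    from Z0(3)[OF this] have "card (N z \<inter> X) \<le> 8 / 100 * real m" .
    moreover have "card (N z \<inter> (X - I)) \<le> card (N z \<inter> X)"
      by (intro card_mono) auto
    ultimately show "card (N z \<inter> (X - I)) \<le> 267 / 10000 * real (card V)" using m by linarith
  qed (use Z0 V in \<open>auto simp: algebra_simps\<close>)
  have "card (A - I) \<le> 32 / 1000 * real (card V)"
    by (rule side[where Z = B and ?Z0.0 = B0])
      (use parts finp A B indep degR big in \<open>auto simp: B0_def\<close>)
  moreover have "card (B - I) \<le> 32 / 1000 * real (card V)"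
    by (rule side[where Z = A and ?Z0.0 = A0])
      (use parts finp A B indep' degR big in \<open>auto simp: A0_def add_ac\<close>)
  moreover have "card (V - I) \<le> card (A - I) + card (B - I) + card R"
  proof -
    have "card (V - I) \<le> card ((A - I) \<union> (B - I) \<union> R)"
      using finp by (intro card_mono) (auto simp: R_def)
    then show ?thesis
      using card_Un_le[of "(A - I) \<union> (B - I)" R] card_Un_le[of "A - I" "B - I"] by linarith
  qed
  ultimately have "card (V - I) \<le> 4 / 10 * real (card V)"
    using cardR m by linarith
  moreover have "N v \<inter> I \<noteq> {}" if "v \<in> V - I" for v
    using that YI unfolding I_def by blast
  ultimately show ?thesis
    using I_indep by (intro exI[of _ I]) (auto simp: I_def)
qed

section \<open>Colouring around a large independent set\<close>

lemma nbhd_indep: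
  assumes "u \<in> N y" "v \<in> N y"
  shows "u \<notin> N v"
  using assms sym triangle_free by blast

lemma exists_popular_nbhd:
  fixes c :: real
  assumes fins: "finite X" "finite Y" and ne: "Y \<noteq> {}"
    and c: "\<And>x. x \<in> X \<Longrightarrow> c * card Y \<le> card (N x \<inter> Y)"
  shows "\<exists>y\<in>Y. c * card X \<le> card (N y \<inter> X)"
proof (rule ccontr)
  assume "\<not> ?thesis"
  then have "(\<Sum>y\<in>Y. real (card (N y \<inter> X))) < (\<Sum>y\<in>Y. c * card X)"
    using fins ne by (intro sum_strict_mono) (auto simp: not_le)
  also have "\<dots> = (\<Sum>x\<in>X. c * card Y)" by simp
  also have "\<dots> \<le> (\<Sum>x\<in>X. real (card (N x \<inter> Y)))"
    using c by (rule sum_mono)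
  also have "\<dots> = (\<Sum>y\<in>Y. real (card (N y \<inter> X)))"
    using double_count[OF fins] by (simp flip: of_nat_sum)
  finally show False by simp
qed

text \<open>Some neighbourhood of a vertex of \<open>Y\<close> covers at least the fraction
  \<open>c\<close> of what is left; being independent, it takes one colour.\<close>

lemma greedy_nbhd_cover:
  fixes c :: real
  assumes fins: "finite X" "finite Y" and ne: "Y \<noteq> {}" and c1: "c \<le> 1"
    and c: "\<And>x. x \<in> X \<Longrightarrow> c * card Y \<le> card (N x \<inter> Y)"
  shows "\<exists>R\<subseteq>X. card R \<le> (1 - c) ^ j * card X \<and> colorable_on (X - R) j"
proof (induction j)
  case 0
  then show ?case by (intro exI[of _ X]) (auto simp: colorable_on_def)
next
  case (Suc j)
  then obtain R where R: "R \<subseteq> X" "card R \<le> (1 - c) ^ j * card X" "colorable_on (X - R) j"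
    by blast
  have finR: "finite R" using R(1) fins finite_subset by blast
  obtain y where y: "y \<in> Y" "c * card R \<le> card (N y \<inter> R)"
    using exists_popular_nbhd[OF finR fins(2) ne] c R(1) by blast
  have "card R = card (R - N y) + card (N y \<inter> R)"
    using finR card_Diff_subset_Int[of R "N y"] card_mono[of R "N y \<inter> R"]
    by (simp add: Int_commute)
  then have "card (R - N y) \<le> (1 - c) * card R"
    using y(2) by (simp add: algebra_simps)
  also have "\<dots> \<le> (1 - c) * ((1 - c) ^ j * card X)"
    using R(2) c1 by (intro mult_left_mono) auto
  finally have "card (R - N y) \<le> (1 - c) ^ Suc j * card X" by simp
  moreover have "colorable_on ((X - R) \<union> (N y \<inter> R)) (j + 1)"
    using R(3) by (intro colorable_on_Un colorable_on_indep) (use nbhd_indep in auto)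
  then have "colorable_on (X - (R - N y)) (Suc j)"
    by (rule colorable_on_mono) auto
  ultimately show ?case using R(1) by (intro exI[of _ "R - N y"]) auto
qed

text \<open>The budget is one colour for \<open>I\<close>, one for \<open>Z\<close>, six for
  \<open>H\<close> and \<open>t + 7\<close> for \<open>W - H\<close>.\<close>

lemma colorable_of_large_indep:
  fixes m f t :: nat
  assumes I: "I \<subseteq> V" "\<And>u v. u \<in> I \<Longrightarrow> v \<in> I \<Longrightarrow> u \<notin> N v"
    and small: "card (V - I) \<le> 4 / 10 * real (card V)"
    and meets: "\<And>v. v \<in> V - I \<Longrightarrow> N v \<inter> I \<noteq> {}"
    and deg: "\<And>v. v \<in> V \<Longrightarrow> m \<le> card (N v)"
    and m: "3333 / 10000 * card V \<le> m" "m \<le> card V / 3" "card V / 3 - f \<le> real m"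
    and V: "card V > 0"
    and few: "\<And>U. U \<subseteq> V \<Longrightarrow> card U \<le> f \<Longrightarrow>
      (\<And>w. w \<in> U \<Longrightarrow> card V / 3 - 10 * f \<le> card (N w \<inter> I)) \<Longrightarrow> colorable_on U t"
  shows "colorable_on V (t + 15)"
proof -
  define J where "J = V - I"
  have finI: "finite I" using finite_subset[OF I(1) fin] .
  have finJ: "finite J" unfolding J_def by simp
  have cardIJ: "card I + card J = card V"
    unfolding J_def using I(1) finI card_mono[OF fin I(1)] by (simp add: card_Diff_subset)
  have smallJ: "real (card J) \<le> 4 / 10 * card V" using small unfolding J_def .
  have largeI: "6 / 10 * card V \<le> real (card I)" using cardIJ smallJ by linarith
  have neI: "I \<noteq> {}" using largeI V by auto
  have NI: "N y \<subseteq> J" if "y \<in> I" for y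
    using that I sub[of y] unfolding J_def by (auto dest: sym)
  have mJ: "m \<le> card J"
  proof -
    from neI obtain y where "y \<in> I" by blast
    then have "m \<le> card (N y)" "card (N y) \<le> card J"
      using I(1) deg NI card_mono[OF finJ] by auto
    then show ?thesis by linarith
  qed
  have split: "card (N v) = card (N v \<inter> I) + card (N v \<inter> J)" for v
  proof -
    have "N v = (N v \<inter> I) \<union> (N v \<inter> J)" using sub[of v] unfolding J_def by blast
    moreover have "card ((N v \<inter> I) \<union> (N v \<inter> J)) = card (N v \<inter> I) + card (N v \<inter> J)"
      by (intro card_Un_disjoint) (auto simp: J_def)
    ultimately show ?thesis by simp
  qed
  \<comment> \<open>A neighbour \<open>y\<close> in \<open>I\<close> has at least \<open>m\<close>
    neighbours, all in \<open>J\<close> and outside \<open>N v\<close>; so \<open>v\<close> has at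
    most \<open>card J - m\<close> neighbours in \<open>J\<close>.\<close>
  have toI: "2 * m \<le> card (N v \<inter> I) + card J" if v: "v \<in> J" for v
  proof -
    from meets v obtain y where y: "y \<in> N v" "y \<in> I" unfolding J_def by blast
    have "N y \<inter> J = N y" using NI[OF y(2)] by blast
    then have "card (N y) + card (N v \<inter> J) \<le> card J"
      using card_Un_nbhds_le[OF y(1) finJ] by simp
    moreover have "m \<le> card (N y)" "m \<le> card (N v)"
      using deg y(2) v I(1) unfolding J_def by auto
    ultimately show ?thesis using split[of v] by linarith
  qed
  \<comment> \<open>The threshold is chosen so that \<open>Z\<close> is isolated in
    \<open>J\<close>: a vertex above it and a neighbour in \<open>J\<close>, which has at least
    \<open>2 * m - card J\<close> neighbours in \<open>I\<close>, would need more than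
    \<open>card I\<close> vertices.\<close>
  define W where "W = {v \<in> J. card (N v \<inter> I) + 2 * m \<le> card V}"
  define Z where "Z = J - W"
  have finW: "finite W" unfolding W_def using finJ by simp
  have Z_isolated: "w \<notin> N z" if "z \<in> Z" "w \<in> J" for z w
  proof
    assume "w \<in> N z"
    then have "card (N w \<inter> I) + card (N z \<inter> I) \<le> card I"
      by (rule card_Un_nbhds_le) (rule finI)
    moreover have "card V < card (N z \<inter> I) + 2 * m"
      using that unfolding Z_def W_def by auto
    ultimately show False using toI[OF that(2)] cardIJ by linarith
  qed
  have NW: "N w \<inter> J = N w \<inter> W" if "w \<in> W" for w
  proof -
    have "u \<in> W" if u: "u \<in> N w" "u \<in> J" for u
      using Z_isolated[of u w] sym[OF u(1)] u(2) \<open>w \<in> W\<close> unfolding Z_def W_def by blast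
    then show ?thesis unfolding W_def by blast
  qed
  define d where "d w = card (N w \<inter> W)" for w
  have degI: "m \<le> card (N w \<inter> I) + d w" if "w \<in> W" for w
    using split[of w] NW[OF that] deg[of w] that unfolding d_def W_def J_def by simp
  \<comment> \<open>Some \<open>y\<close> in \<open>I\<close> sees at most 0.56 of \<open>W\<close>,
    as 0.3334 < 0.56 * 0.6. Its neighbours lie in \<open>W\<close> and \<open>Z\<close>, which
    forces \<open>card J\<close> to be at least \<open>m\<close> plus 0.44 \<open>card W\<close>.
    Thus \<open>I\<close> is so small that the degrees of \<open>u\<close> and \<open>v\<close>
    inside \<open>W\<close> must compensate, up to
    \<open>3 * m - card V \<ge> - 3 * f\<close>.\<close>
  have edgeW: "44 / 100 * card W - 3 * real f \<le> d u + d v" if uv: "u \<in> W" "v \<in> W" "u \<in> N v" for u v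
  proof -
    have "\<exists>y\<in>I. card (N y \<inter> W) \<le> 56 / 100 * real (card W)"
    proof (rule ccontr)
      assume "\<not> ?thesis"
      then have "(\<Sum>y\<in>I. 56 / 100 * real (card W)) < (\<Sum>y\<in>I. real (card (N y \<inter> W)))"
        using finI neI by (intro sum_strict_mono) (auto simp: not_le)
      also have "\<dots> = (\<Sum>w\<in>W. real (card (N w \<inter> I)))"
        using double_count[OF finI finW] by (simp flip: of_nat_sum)
      also have "\<dots> \<le> (\<Sum>w\<in>W. 3334 / 10000 * real (card V))"
      proof (rule sum_mono)
        fix w assume "w \<in> W"
        then have "card (N w \<inter> I) + 2 * m \<le> card V" unfolding W_def by blast
        then show "real (card (N w \<inter> I)) \<le> 3334 / 10000 * real (card V)"
          using m by linarith
      qed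
      finally have "card I * (56 / 100 * real (card W)) < card W * (3334 / 10000 * real (card V))"
        by simp
      moreover have "card W * (3334 / 10000 * real (card V)) \<le> card W * (56 / 100 * real (card I))"
        using largeI by (intro mult_left_mono) auto
      ultimately show False by (simp add: algebra_simps)
    qed
    then obtain y where y: "y \<in> I" "card (N y \<inter> W) \<le> 56 / 100 * real (card W)" by blast
    have "card (N y) \<le> card (N y \<inter> W) + card Z"
    proof -
      have "card (N y) \<le> card ((N y \<inter> W) \<union> Z)"
        using NI[OF y(1)] finJ unfolding Z_def by (intro card_mono) auto
      then show ?thesis using card_Un_le[of "N y \<inter> W" Z] by linarith
    qed
    moreover have "card Z + card W = card J"
      unfolding Z_def using finW finJ card_mono[OF finJ, of W]
      by (simp add: card_Diff_subset W_def)
    moreover have "m \<le> card (N y)" using deg y(1) I(1) by blast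
    moreover have "card (N u \<inter> I) + card (N v \<inter> I) \<le> card I"
      by (rule card_Un_nbhds_le[OF uv(3) finI])
    ultimately show ?thesis using degI[OF uv(1)] degI[OF uv(2)] y(2) cardIJ m(3) by linarith
  qed
  define H where "H = {w \<in> W. card W \<le> 6 * d w}"
  have colH: "colorable_on H 6"
  proof -
    \<comment> \<open>A maximal family with disjoint neighbourhoods in \<open>W\<close> has at most
      six members, each using a sixth of \<open>W\<close>; every vertex of \<open>H\<close> shares a
      neighbour in \<open>W\<close> with a member, which determines its colour.\<close>
    define \<F> where "\<F> = {F. F \<subseteq> H \<and> (\<forall>x\<in>F. \<forall>y\<in>F. x \<noteq> y \<longrightarrow> N x \<inter> N y \<inter> W = {})}"
    have finH: "finite H" unfolding H_def using finW by simp
    then have fin\<F>: "finite \<F>" unfolding \<F>_def by simp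
    moreover have "{} \<in> \<F>" unfolding \<F>_def by simp
    ultimately obtain F where F: "F \<in> \<F>" and max: "\<And>F'. F' \<in> \<F> \<Longrightarrow> F \<subseteq> F' \<Longrightarrow> F = F'"
      using finite_has_maximal[of \<F>] by blast
    have FH: "F \<subseteq> H" using F unfolding \<F>_def by blast
    have finF: "finite F" using FH finH finite_subset by blast
    have hit: "\<exists>x\<in>F. N w \<inter> N x \<inter> W \<noteq> {}" if w: "w \<in> H" for w
    proof (cases "w \<in> F")
      case True
      have "card W > 0" using w finW unfolding H_def by (auto simp: card_gt_0_iff)
      then have "N w \<inter> W \<noteq> {}" using w unfolding H_def d_def by auto
      then show ?thesis using True by blast
    next
      case False
      show ?thesis
      proof (rule ccontr)
        assume "\<not> ?thesis"
        then have "insert w F \<in> \<F>" using F w unfolding \<F>_def by blast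
        from max[OF this] False show False by blast
      qed
    qed
    have "card F \<le> 6"
    proof (cases "F = {}")
      case False
      then have W_pos: "card W > 0" using FH finW unfolding H_def by (auto simp: card_gt_0_iff)
      have "card F * card W = (\<Sum>x\<in>F. card W)" by simp
      also have "\<dots> \<le> (\<Sum>x\<in>F. 6 * card (N x \<inter> W))"
        using FH unfolding H_def d_def by (intro sum_mono) auto
      also have "\<dots> = 6 * card (\<Union>x\<in>F. N x \<inter> W)"
      proof -
        have "card (\<Union>x\<in>F. N x \<inter> W) = (\<Sum>x\<in>F. card (N x \<inter> W))"
          using finF F unfolding \<F>_def by (intro card_UN_disjoint) auto
        then show ?thesis by (simp add: sum_distrib_left)
      qed
      also have "\<dots> \<le> 6 * card W"
        using finW by (intro mult_left_mono card_mono) auto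
      finally show ?thesis using W_pos by simp
    qed simp
    obtain h where h: "bij_betw h {0..<card F} F"
      using ex_bij_betw_nat_finite[OF finF] by blast
    have "colorable_on H (card F)"
    proof (rule colorable_on_indep_cover[where S = "\<lambda>i. {w \<in> H. N w \<inter> N (h i) \<inter> W \<noteq> {}}"])
      fix w assume w: "w \<in> H"
      from hit[OF w] obtain x where x: "x \<in> F" "N w \<inter> N x \<inter> W \<noteq> {}" by blast
      from h x(1) have "x \<in> h ` {0..<card F}" by (simp add: bij_betw_def)
      then obtain i where "i < card F" "h i = x" by auto
      then show "\<exists>i<card F. w \<in> {w \<in> H. N w \<inter> N (h i) \<inter> W \<noteq> {}}" using w x by blast
    next
      fix i u v
      assume i: "i < card F" and u: "u \<in> {w \<in> H. N w \<inter> N (h i) \<inter> W \<noteq> {}}"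
        and v: "v \<in> {w \<in> H. N w \<inter> N (h i) \<inter> W \<noteq> {}}"
      define x where "x = h i"
      have x: "x \<in> W" using i h FH unfolding bij_betw_def H_def x_def by auto
      \<comment> \<open>The common neighbour \<open>a\<close> has at least
        \<open>2 * m - card J\<close> neighbours in \<open>I\<close>, outside \<open>N w\<close> and
        \<open>N x\<close>. These two sets are thus confined to \<open>card V - 2 * m\<close>
        vertices of \<open>I\<close> and overlap.\<close>
      have inter: "4 * real m \<le> card (N w \<inter> I \<inter> (N x \<inter> I)) + 2 * real (card J) + (card V - 2 * real m)"
        if w: "w \<in> H" "N w \<inter> N x \<inter> W \<noteq> {}" for w
      proof -
        from w(2) obtain a where a: "a \<in> N w" "a \<in> N x" "a \<in> W" by blast
        have "card ((N w \<inter> I) \<union> (N x \<inter> I)) + card (N a \<inter> I) = card ((N w \<inter> I) \<union> (N x \<inter> I) \<union> (N a \<inter> I))"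
          using triangle_free[OF a(1)] triangle_free[OF a(2)] by (intro card_Un_disjoint[symmetric]) auto
        also have "\<dots> \<le> card I" by (intro card_mono finI) auto
        finally have "card ((N w \<inter> I) \<union> (N x \<inter> I)) + card (N a \<inter> I) \<le> card I" .
        moreover have "card (N w \<inter> I) + card (N x \<inter> I)
            = card ((N w \<inter> I) \<union> (N x \<inter> I)) + card (N w \<inter> I \<inter> (N x \<inter> I))"
          by (intro card_Un_Int) auto
        moreover have "a \<in> J" "w \<in> J" "x \<in> J" using a w x unfolding W_def H_def by auto
        note toI[OF this(1)] toI[OF this(2)] toI[OF this(3)]
        ultimately show ?thesis using cardIJ by linarith
      qed
      have le: "card (N x \<inter> I) + 2 * m \<le> card V" using x unfolding W_def by blast
      show "u \<notin> N v"
      proof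
        assume "u \<in> N v"
        then have "card (N u \<inter> (N x \<inter> I)) + card (N v \<inter> (N x \<inter> I)) \<le> card (N x \<inter> I)"
          by (rule card_Un_nbhds_le) simp
        moreover have "N w \<inter> I \<inter> (N x \<inter> I) = N w \<inter> (N x \<inter> I)" for w by blast
        \<comment> \<open>With \<open>card J\<close> at most 0.4 \<open>card V\<close>, this would
          give 14 \<open>m\<close> <= 4.6 \<open>card V\<close>, but 14 * 0.3333 > 4.6.\<close>
        ultimately have "8 * real m \<le> 4 * real (card J) + 3 * (card V - 2 * real m)"
          using inter[of u] inter[of v] u v le unfolding x_def[symmetric] by simp
        moreover have "0 < real (card V)" using V by simp
        moreover have "10 * real (card J) \<le> 4 * real (card V)" using smallJ by simp
        moreover have "3333 * real (card V) \<le> 10000 * real m" using m(1) by simp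
        ultimately show False by (simp add: algebra_simps)
      qed
    qed
    then show ?thesis using \<open>card F \<le> 6\<close> colorable_on_mono by blast
  qed
  have colL: "colorable_on (W - H) (t + 7)"
  \<comment> \<open>Above the threshold an edge contradicts \<open>edgeW\<close>, since both degrees
    are below \<open>card W / 6\<close> and 29 * (0.44 - 1/3) > 3. Below it, seven greedy
    neighbourhoods leave at most \<open>f\<close> vertices, since
    \<open>0.61 ^ 7 * 29 < 1\<close>.\<close>
  proof (cases "real (card W) < 29 * f")
    case False
    have "colorable_on (W - H) 1"
    proof (rule colorable_on_indep)
      fix u v assume uv: "u \<in> W - H" "v \<in> W - H"
      show "u \<notin> N v"
      proof
        assume "u \<in> N v"
        then have "44 / 100 * card W - 3 * real f \<le> d u + d v" using edgeW uv by blast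
        moreover have "6 * d u < card W" "6 * d v < card W" using uv unfolding H_def by auto
        ultimately show False using False by linarith
      qed
    qed
    then show ?thesis by (rule colorable_on_mono) auto
  next
    case True
    have "39 / 100 * card I \<le> card (N w \<inter> I)" if "w \<in> W - H" for w
    proof -
      have "w \<in> J" using that unfolding W_def by blast
      from toI[OF this] show ?thesis using smallJ mJ cardIJ m by linarith
    qed
    then obtain U where U: "U \<subseteq> W - H" "card U \<le> (1 - 39 / 100) ^ 7 * card (W - H)"
      "colorable_on (W - H - U) 7"
      using greedy_nbhd_cover[of "W - H" I "39 / 100" 7] finW finI neI by auto
    have "colorable_on U t"
    proof (rule few)
      show "U \<subseteq> V" using U(1) unfolding W_def J_def by blast
      have "real (card U) \<le> (1 - 39 / 100) ^ 7 * card (W - H)" by (rule U(2))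
      also have "\<dots> \<le> (1 - 39 / 100) ^ 7 * (29 * f)"
      proof (rule mult_left_mono)
        have "card (W - H) \<le> card W" using finW by (intro card_mono) auto
        then show "real (card (W - H)) \<le> 29 * f" using True by linarith
      qed simp
      also have "\<dots> \<le> f" by (simp add: divide_simps)
      finally show "card U \<le> f" by simp
    next
      fix w assume "w \<in> U"
      then have w: "w \<in> W" "w \<notin> H" using U(1) by auto
      then have "6 * d w < card W" unfolding H_def by auto
      \<comment> \<open>Here \<open>d w\<close> is below \<open>29 * f / 6\<close>, hence below
        \<open>5 * f\<close>, and \<open>m\<close> loses at most another \<open>f\<close>.\<close>
      then show "card V / 3 - 10 * f \<le> card (N w \<inter> I)" using degI[OF w(1)] True m(3) by linarith
    qed
    from colorable_on_Un[OF this U(3)] show ?thesis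
      by (rule colorable_on_mono) auto
  qed
  have "colorable_on I 1" using I(2) by (rule colorable_on_indep)
  moreover have "colorable_on Z 1"
    using Z_isolated by (intro colorable_on_indep) (auto simp: Z_def)
  ultimately have "colorable_on (I \<union> Z \<union> H \<union> (W - H)) (1 + 1 + 6 + (t + 7))"
    using colH colL by (intro colorable_on_Un)
  then show ?thesis
    by (rule colorable_on_mono) (auto simp: Z_def J_def)
qed

text \<open>The uncoloured vertices either are independent, costing one more colour, or contain an
  edge, which yields \<open>I\<close>. The hypothesis \<open>few\<close> ranges over all
  \<open>I\<close> because this set only arises inside the proof.\<close>

lemma colorable_of_few_indep:
  fixes m f t :: nat
  assumes deg: "\<And>v. v \<in> V \<Longrightarrow> m \<le> card (N v)"
    and m: "3333 / 10000 * card V \<le> m" "m \<le> card V / 3" "card V / 3 - f \<le> real m"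
    and V: "card V > 0"
    and few: "\<And>I U. I \<subseteq> V \<Longrightarrow> (\<And>u v. u \<in> I \<Longrightarrow> v \<in> I \<Longrightarrow> u \<notin> N v) \<Longrightarrow> I \<noteq> {} \<Longrightarrow>
      U \<subseteq> V \<Longrightarrow> card U \<le> f \<Longrightarrow>
      (\<And>w. w \<in> U \<Longrightarrow> card V / 3 - 10 * f \<le> card (N w \<inter> I)) \<Longrightarrow> colorable_on U t"
  shows "colorable_on V (t + 15) \<or> colorable_on V (4 ^ 600 + 1)"
proof -
  define K :: nat where "K = 4 ^ 600"
  obtain S :: "nat \<Rightarrow> 'a set" where S: "\<And>i. S i \<subseteq> V"
    and alt: "\<And>v. (\<exists>i < K. 2 * card (N v \<inter> S i) > card (S i)) \<or>
      (\<forall>A \<subseteq> N v. card A = m \<longrightarrow>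
        574 / 1000 * card V \<le> card {u \<in> V. card (N u \<inter> A) \<le> 8 / 100 * real m})"
    using exists_majority_sets_third[OF V m(1)] unfolding K_def by blast
  define M where "M i = {v \<in> V. 2 * card (N v \<inter> S i) > card (S i)}" for i
  define X where "X = {v \<in> V. \<exists>i < K. v \<in> M i}"
  have colX: "colorable_on X (K)"
  proof (rule colorable_on_indep_cover[where S = M])
    show "\<exists>i<K. v \<in> M i" if "v \<in> X" for v
      using that by (simp only: X_def mem_Collect_eq)
    show "u \<notin> N v" if "u \<in> M i" "v \<in> M i" for i u v
      using that majority_indep[OF finite_subset[OF S fin]] unfolding M_def by blast
  qed
  show ?thesis
  proof (cases "\<exists>v\<in>V - X. \<exists>w\<in>V - X. w \<in> N v")
    case False
    then have "colorable_on (V - X) 1"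
      by (intro colorable_on_indep) blast
    from colorable_on_Un[OF colX this] have "colorable_on V (K + 1)"
      by (rule colorable_on_mono) auto
    then show ?thesis unfolding K_def ..
  next
    case True
    then obtain v w where vw: "v \<in> V - X" "w \<in> V - X" "w \<in> N v" by blast
    obtain A where A: "A \<subseteq> N v" "card A = m"
      using deg[of v] vw obtain_subset_with_card_n by blast
    obtain B where B: "B \<subseteq> N w" "card B = m"
      using deg[of w] vw obtain_subset_with_card_n by blast
    have wide: "574 / 1000 * card V \<le> card {u \<in> V. card (N u \<inter> C) \<le> 8 / 100 * real m}"
      if "x \<in> V - X" "C \<subseteq> N x" "card C = m" for x C
      using alt[of x] that unfolding X_def M_def by blast
    obtain I where I: "I \<subseteq> V" "\<forall>u\<in>I. \<forall>v\<in>I. u \<notin> N v"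
      and small: "card (V - I) \<le> 4 / 10 * real (card V)"
      and meets: "\<forall>v\<in>V - I. N v \<inter> I \<noteq> {}"
      using large_indep_of_wide_edge[OF vw(3) A B deg m(1,2) V wide[OF vw(1) A] wide[OF vw(2) B]]
      by blast
    have "I \<noteq> {}" using small V by force
    have "colorable_on V (t + 15)"
    proof (rule colorable_of_large_indep[OF I(1) _ small _ deg m V])
      show "u \<notin> N v" if "u \<in> I" "v \<in> I" for u v using I(2) that by blast
      show "N v \<inter> I \<noteq> {}" if "v \<in> V - I" for v using meets that by blast
      show "colorable_on U t"
        if "U \<subseteq> V" "card U \<le> f" "\<And>w. w \<in> U \<Longrightarrow> card V / 3 - 10 * f \<le> card (N w \<inter> I)" for U
        by (rule few[OF I(1) _ \<open>I \<noteq> {}\<close> that]) (use I(2) in blast)+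
    qed
    then show ?thesis ..
  qed
qed

end

section \<open>Transfer to Kneser graphs\<close>

lemma diff_less_binomial:
  assumes "0 < k" "k < n"
  shows "n - k < n choose k"
proof -
  \<comment> \<open>Fixing the first \<open>k - 1\<close> elements and varying the last one already
    gives \<open>n - k + 1\<close> sets.\<close>
  have "(\<lambda>x. insert x {1..<k}) ` {k..n} \<subseteq> {A. A \<subseteq> {1..n} \<and> card A = k}"
    using assms by (auto simp: card_insert_if)
  then have "card ((\<lambda>x. insert x {1..<k}) ` {k..n}) \<le> card {A. A \<subseteq> {1..n} \<and> card A = k}"
    by (intro card_mono) auto
  moreover have "inj_on (\<lambda>x. insert x {1..<k}) {k..n}"
    by (auto simp: inj_on_def)
  ultimately show ?thesis
    using assms n_subsets[of "{1..n}" k] by (simp add: card_image)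
qed

text \<open>The hypothesis concerns exactly \<open>s\<close> vertices, while \<open>K\<close> may
  have a smaller image; the image is padded inside the Kneser graph, which is large enough as
  \<open>s \<le> p + k\<close>, and the colouring is pulled back along \<open>K\<close>.\<close>

lemma colorable_disjoint_family:
  fixes U :: "'a set" and K :: "'a \<Rightarrow> nat set"
  assumes kneser: "\<And>H. pair_graph H \<Longrightarrow> subgraph (with_proj H) (with_proj (kneser_graph p k)) \<Longrightarrow>
      card (pverts H) = s \<Longrightarrow> colorable H t"
    and p: "p > 0" and s: "s \<le> p + k"
    and U: "finite U" "card U \<le> s"
    and K: "\<And>u. u \<in> U \<Longrightarrow> K u \<subseteq> {1..2 * p + k} \<and> card (K u) = p"
  shows "\<exists>c :: 'a \<Rightarrow> nat. (\<forall>u\<in>U. c u < t) \<and> (\<forall>u\<in>U. \<forall>v\<in>U. K u \<inter> K v = {} \<longrightarrow> c u \<noteq> c v)"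
proof -
  define X where "X = {A. A \<subseteq> {1..2 * p + k} \<and> card A = p}"
  have finX: "finite X"
    unfolding X_def by (rule finite_subset[of _ "Pow {1..2 * p + k}"]) auto
  have "s \<le> card X"
    using diff_less_binomial[of p "2 * p + k"] p s n_subsets[of "{1..2 * p + k}" p]
    unfolding X_def by simp
  moreover have "K ` U \<subseteq> X" using K unfolding X_def by blast
  moreover have "card (K ` U) \<le> s" using card_image_le[OF U(1), of K] U(2) by linarith
  ultimately obtain Y where Y: "K ` U \<subseteq> Y" "Y \<subseteq> X" "card Y = s"
    using exists_subset_between[of "K ` U" s X] finX by blast
  define H where "H = \<lparr>pverts = Y, parcs = {(A, B). A \<in> Y \<and> B \<in> Y \<and> A \<inter> B = {}}\<rparr>"
  have H: "pverts H = Y" "parcs H = {(A, B). A \<in> Y \<and> B \<in> Y \<and> A \<inter> B = {}}"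
    unfolding H_def by simp_all
  have kg: "pverts (kneser_graph p k) = X"
    "parcs (kneser_graph p k) = {(A, B). A \<in> X \<and> B \<in> X \<and> A \<inter> B = {}}"
    unfolding kneser_graph_def X_def Let_def by simp_all
  interpret kg: pair_graph "kneser_graph p k"
    by (rule pair_graph_kneser_graph[OF p])
  have finY: "finite Y" using Y(2) finX finite_subset by blast
  have ne: "A \<noteq> {}" if "A \<in> Y" for A
    using that Y(2) p unfolding X_def by auto
  have pg: "pair_graph H"
  proof
    show "finite (parcs H)"
      unfolding H(2) by (rule finite_subset[of _ "Y \<times> Y"]) (use finY in auto)
    show "symmetric (with_proj H)"
      unfolding symmetric_def with_proj_simps H(2) by (rule symI) blast
    show "fst e \<noteq> snd e" if "e \<in> parcs H" for e
      using that ne unfolding H(2) by force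
  qed (use finY in \<open>auto simp: H\<close>)
  interpret H: pair_graph H by (rule pg)
  have "subgraph (with_proj H) (with_proj (kneser_graph p k))"
    unfolding subgraph_def compatible_def
    using H.wf_digraph kg.wf_digraph Y(2) by (auto simp: H kg)
  then have "colorable H t" using kneser[OF pg] Y(3) H(1) by simp
  then obtain c where c: "\<forall>A\<in>Y. c A < t" "\<forall>(A, B)\<in>parcs H. c A \<noteq> c B"
    unfolding colorable_def H(1) by blast
  show ?thesis
  proof (intro exI[of _ "c \<circ> K"] conjI ballI impI)
    fix u v assume "u \<in> U" "v \<in> U" "K u \<inter> K v = {}"
    then have "(K u, K v) \<in> parcs H" using Y(1) unfolding H(2) by blast
    then show "(c \<circ> K) u \<noteq> (c \<circ> K) v" using c(2) by auto
  qed (use c(1) Y(1) in auto)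
qed

lemma colorable_min_degree_third:
  fixes G :: "'a pair_pre_digraph" and f t n :: nat
  defines "p \<equiv> nat \<lceil>real n / 3 - 10 * real f\<rceil>"
  assumes kneser: "\<And>H. pair_graph H \<Longrightarrow>
      subgraph (with_proj H) (with_proj (kneser_graph p (21 * f))) \<Longrightarrow>
      card (pverts H) = f \<Longrightarrow> colorable H t"
    and G: "pair_graph G" "card (pverts G) = n" "clique_free 3 G"
    and deg: "real (min_degree G) \<ge> real n / 3 - real f"
    and f: "1 \<le> f" "100000 * f \<le> n"
  shows "colorable G (t + 10 ^ 391)"
proof -
  interpret G: pair_graph G by (rule G(1))
  define N where "N v = {u. (v, u) \<in> parcs G}" for v
  have symG: "(v, u) \<in> parcs G" if "(u, v) \<in> parcs G" for u v
    using G.sym_arcs that unfolding symmetric_def by (auto dest: symD)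
  have no_triangle: False if "(u, v) \<in> parcs G" "(u, w) \<in> parcs G" "(v, w) \<in> parcs G" for u v w
  proof -
    have neq: "u \<noteq> v" "u \<noteq> w" "v \<noteq> w"
      using that G.pair_no_loops by fastforce+
    define H where "H = \<lparr>pverts = {u, v, w}, parcs = {(x, y). x \<in> {u, v, w} \<and> y \<in> {u, v, w} \<and> x \<noteq> y}\<rparr>"
    have complete: "complete_digraph 3 (with_proj H)"
      unfolding complete_digraph_pair_def H_def using neq by auto
    then interpret H: pair_graph H
      by (rule pair_graphI_complete)
    have "subgraph (with_proj H) (with_proj G)"
      unfolding subgraph_def compatible_def
      using H.wf_digraph G.wf_digraph that symG G.in_arcsD1 G.in_arcsD2 by (auto simp: H_def)
    with complete G(3) show False unfolding clique_free_def by blast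
  qed
  interpret triangle_free_nbhds "pverts G" N
  proof
    show "finite (pverts G)" by (rule G.pair_finite_verts)
    show "N v \<subseteq> pverts G" for v unfolding N_def using G.in_arcsD2 by blast
    show "u \<in> N v \<Longrightarrow> v \<in> N u" for u v unfolding N_def using symG by blast
    show "u \<in> N v \<Longrightarrow> N u \<inter> N v = {}" for u v unfolding N_def using no_triangle by blast
  qed
  \<comment> \<open>Rounding up keeps \<open>m\<close> at most \<open>n / 3\<close> because
    \<open>f \<ge> 1\<close>.\<close>
  define m where "m = nat \<lceil>real n / 3 - real f\<rceil>"
  have m: "real n / 3 - f \<le> m" "real m < real n / 3 - f + 1"
    unfolding m_def using f by linarith+
  have p: "real n / 3 - 10 * f \<le> p" "p > 0"
    unfolding p_def using f by linarith+
  have n: "card (pverts G) > 0" using G(2) f by simp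
  have degN: "m \<le> card (N v)" if v: "v \<in> pverts G" for v
  proof -
    have "min_degree G \<le> out_degree (with_proj G) v"
      unfolding min_degree_def using v by (intro Min_le) auto
    also have "\<dots> = card ((\<lambda>u. (v, u)) ` N v)"
      unfolding out_degree_def out_arcs_def N_def
      by (intro arg_cong[of _ _ card]) auto
    also have "\<dots> = card (N v)"
      by (intro card_image) (auto simp: inj_on_def)
    finally show ?thesis using deg unfolding m_def by linarith
  qed
  have few: "colorable_on U t"
    if I: "I \<subseteq> pverts G" "\<And>u v. u \<in> I \<Longrightarrow> v \<in> I \<Longrightarrow> u \<notin> N v" "I \<noteq> {}"
      and U: "U \<subseteq> pverts G" "card U \<le> f"
        "\<And>w. w \<in> U \<Longrightarrow> card (pverts G) / 3 - 10 * f \<le> card (N w \<inter> I)" for I U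
  proof -
    have finI: "finite I" by (rule finite_subset[OF I(1) fin])
    \<comment> \<open>\<open>I\<close> is disjoint from \<open>N y\<close>, so it has at most
      \<open>2 * n / 3 + f\<close> vertices; since \<open>p \<ge> n / 3 - 10 * f\<close>, adding
      \<open>21 * f\<close> to \<open>2 * p\<close> makes up for this.\<close>
    have cardI: "card I \<le> 2 * p + 21 * f"
    proof -
      from I(3) obtain y where y: "y \<in> I" by blast
      have "card (I \<union> N y) \<le> card (pverts G)"
        using I(1) sub by (intro card_mono) auto
      moreover have "card (I \<union> N y) = card I + card (N y)"
        using finI I(2)[OF _ y] by (intro card_Un_disjoint) auto
      ultimately have "real (card I) + m \<le> n"
        using degN[of y] y I(1) G(2) by auto
      then show ?thesis using m p by linarith
    qed
    obtain h where h: "bij_betw h I {1..card I}"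
      using ex_bij_betw_finite_nat[OF finI] ex_bij_betw_nat_finite_1[OF finI] bij_betw_inv by blast
    \<comment> \<open>By integrality the lower bound \<open>n / 3 - 10 * f\<close> rounds up to
      \<open>p\<close>. Shrinking to \<open>p\<close> elements keeps the sets of adjacent vertices
      disjoint.\<close>
    have "\<exists>K. K \<subseteq> h ` (N w \<inter> I) \<and> card K = p" if "w \<in> U" for w
    proof -
      have "card (h ` (N w \<inter> I)) = card (N w \<inter> I)"
        using h by (intro card_image) (auto simp: bij_betw_def inj_on_def)
      then have "p \<le> card (h ` (N w \<inter> I))"
        using U(3)[OF that] G(2) unfolding p_def by linarith
      then show ?thesis using obtain_subset_with_card_n by blast
    qed
    then obtain K where K: "\<And>w. w \<in> U \<Longrightarrow> K w \<subseteq> h ` (N w \<inter> I) \<and> card (K w) = p" by metis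
    have "\<exists>c :: 'a \<Rightarrow> nat. (\<forall>u\<in>U. c u < t) \<and> (\<forall>u\<in>U. \<forall>v\<in>U. K u \<inter> K v = {} \<longrightarrow> c u \<noteq> c v)"
    proof (rule colorable_disjoint_family[OF kneser p(2)])
      show "finite U" by (rule finite_subset[OF U(1) fin])
      show "K u \<subseteq> {1..2 * p + 21 * f} \<and> card (K u) = p" if "u \<in> U" for u
      proof -
        have "h ` (N u \<inter> I) \<subseteq> {1..card I}" using h unfolding bij_betw_def by blast
        then show ?thesis using K[OF that] cardI by fastforce
      qed
    qed (use U in auto)
    then obtain c :: "'a \<Rightarrow> nat" where
      c: "\<forall>u\<in>U. c u < t" "\<forall>u\<in>U. \<forall>v\<in>U. K u \<inter> K v = {} \<longrightarrow> c u \<noteq> c v" by blast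
    have "K u \<inter> K v = {}" if uv: "u \<in> U" "v \<in> U" "u \<in> N v" for u v
    proof -
      have "h ` (N u \<inter> I) \<inter> h ` (N v \<inter> I) = {}"
        using h triangle_free[OF uv(3)] unfolding bij_betw_def inj_on_def by blast
      then show ?thesis using K[OF uv(1)] K[OF uv(2)] by blast
    qed
    then show ?thesis
      unfolding colorable_on_def using c by (intro exI[of _ c]) blast
  qed
  have f_real: "100000 * real f \<le> n" "1 \<le> real f" using f by linarith+
  define a b :: nat where "a = 4 ^ 600" and "b = 10 ^ 391"
  \<comment> \<open>Since 600 = 12 * 50, the estimate \<open>4 ^ 50 \<le> 10 ^ 31\<close> bounds
    \<open>a\<close> by \<open>10 ^ 372\<close>.\<close>
  have "a < b"
  proof -
    have pow: "x ^ 600 = (x ^ 50) ^ 12" "(x ^ 31) ^ 12 = x ^ 372" for x :: nat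
      by (simp_all flip: power_mult)
    have "a = (4 ^ 50) ^ 12"
      unfolding a_def by (rule pow)
    also have "\<dots> \<le> (10 ^ 31) ^ 12"
      by (rule power_mono) simp_all
    also have "\<dots> = 10 ^ 372"
      by (rule pow)
    also have "\<dots> < b"
      unfolding b_def by (rule power_strict_increasing) simp_all
    finally show ?thesis .
  qed
  have "15 \<le> (10 :: nat) ^ 2" by simp
  also have "\<dots> \<le> b"
    unfolding b_def by (rule power_increasing) simp_all
  finally have "15 \<le> b" .
  have "colorable_on (pverts G) (t + 15) \<or> colorable_on (pverts G) (a + 1)"
    unfolding a_def
  proof (rule colorable_of_few_indep[where f = f and m = m])
    show "3333 / 10000 * real (card (pverts G)) \<le> m" "real m \<le> real (card (pverts G)) / 3"
      "real (card (pverts G)) / 3 - real f \<le> m"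
      using m f_real unfolding G(2) by linarith+
  qed (fact degN n few)+
  then have "colorable_on (pverts G) (t + b)"
    using \<open>a < b\<close> \<open>15 \<le> b\<close> by (auto elim: colorable_on_mono)
  then obtain c where c: "\<forall>v\<in>pverts G. c v < t + b"
    "\<forall>u\<in>pverts G. \<forall>v\<in>pverts G. u \<in> N v \<longrightarrow> c u \<noteq> (c v :: nat)"
    unfolding colorable_on_def by blast
  have "c u \<noteq> c v" if "(u, v) \<in> parcs G" for u v
    using c(2) that G.in_arcsD1[OF that] G.in_arcsD2[OF that] symG[OF that] unfolding N_def by blast
  then show ?thesis
    unfolding colorable_def b_def[symmetric] using c(1) by (intro exI[of _ c]) auto
qed

theorem theorem3p2:
  fixes f :: "nat \<Rightarrow> nat" and t :: nat
  assumes "\<And>n. n \<ge> 1 \<Longrightarrow> f n \<ge> 1"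
    and "(\<lambda>n. real (f n)) \<in> o(\<lambda>n. real n)"
    and "t \<ge> 1"
  shows "\<exists>N. \<forall>n\<ge>N.
    (\<forall>H. pair_graph H
        \<and> subgraph (with_proj H)
            (with_proj (kneser_graph (nat \<lceil>real n / 3 - 10 * real (f n)\<rceil>) (21 * f n)))
        \<and> card (pverts H) = f n
        \<longrightarrow> colorable H t)
    \<longrightarrow>
    (\<forall>G :: 'a pair_pre_digraph. pair_graph G
        \<and> card (pverts G) = n
        \<and> clique_free 3 G
        \<and> real (min_degree G) \<ge> real n / 3 - real (f n)
        \<longrightarrow> colorable G (t + 10 ^ 391))"
proof -
  \<comment> \<open>The constant lies below 1/3 - 0.3333 = 1/30000, so minimum degree
    \<open>n / 3 - f n\<close> stays above 0.3333 \<open>n\<close>.\<close>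
  have "\<forall>\<^sub>F n in at_top. norm (real (f n)) \<le> 1 / 100000 * norm (real n)"
    by (rule landau_o.smallD[OF assms(2)]) simp
  then obtain N0 where N0: "\<And>n. n \<ge> N0 \<Longrightarrow> real (f n) \<le> 1 / 100000 * real n"
    unfolding eventually_sequentially by auto
  show ?thesis
  proof (intro exI[of _ "max N0 1"] allI impI)
    fix n and G :: "'a pair_pre_digraph"
    assume n: "max N0 1 \<le> n"
      and kneser: "\<forall>H. pair_graph H
        \<and> subgraph (with_proj H)
            (with_proj (kneser_graph (nat \<lceil>real n / 3 - 10 * real (f n)\<rceil>) (21 * f n)))
        \<and> card (pverts H) = f n
        \<longrightarrow> colorable H t"
      and G: "pair_graph G \<and> card (pverts G) = n \<and> clique_free 3 G
        \<and> real (min_degree G) \<ge> real n / 3 - real (f n)"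
    have "1 \<le> f n" "100000 * f n \<le> n"
      using assms(1)[of n] N0[of n] n by auto
    then show "colorable G (t + 10 ^ 391)"
      using colorable_min_degree_third[of n "f n" t G] kneser G by blast
  qed
qed

end
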